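(* Suppose that the noise random variables $\mathbf{W}_1,\dots,\mathbf{W}_T$ are independent and that the noise process $\mathbf{W}=(\mathbf{W}_1,\dots,\mathbf{W}_T)$ takes a finite number of values. Suppose that the backward induction (Bellman equation) $$\mathcal{V}_T(x,z)=K(x)+\chi_{\{g(x)-z\le 0\}}(x,z),$$ $$\mathcal{V}_t(x,z)=\min_{u\in\mathbb{U}_t}\ \min_{\substack{\sigma(\mathbf{V})\subset\sigma(\mathbf{W}_{t+1})\\ \mathbb{E}[\mathbf{V}]=0}}\ \mathbb{E}\Big[L_t(x,u,\mathbf{W}_{t+1})+\mathcal{V}_{t+1}\big(f_t(x,u,\mathbf{W}_{t+1}),z+\mathbf{V}\big)\Big],\qquad t=T-1,\dots,0,$$ where $\mathbf{V}$ ranges over $\mathbb{R}^m$-valued random variables, is well defined in the sense that all the functions $\mathcal{V}_t:\mathbb{X}_t\times\mathbb{R}^m\to\mathbb{R}_+\cup\{+\infty\}$, $t=0,\dots,T$, are measurable. Then, for the initial states $x_0\in\mathbb{X}_0$ and $z_0\in\mathbb{R}^m$, Problem (B) can be solved by dynamic programming with this associated Bellman equation, and its optimal value is $\mathcal{V}_0(x_0,z_0)$.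
   Context: Setting. $(\Omega,\mathcal{A},\mathbb{P})$ is a probability space, and $T>0$ and $m\ge 1$ are integers. $\mathbb{X}_0,\dots,\mathbb{X}_T$, $\mathbb{U}_0,\dots,\mathbb{U}_{T-1}$, $\mathbb{W}_1,\dots,\mathbb{W}_T$ are measurable spaces; $\mathbf{W}_t$ is a random variable with values in $\mathbb{W}_t$. The following maps are measurable: the dynamics $f_t:\mathbb{X}_t\times\mathbb{U}_t\times\mathbb{W}_{t+1}\to\mathbb{X}_{t+1}$ and the instantaneous costs $L_t:\mathbb{X}_t\times\mathbb{U}_t\times\mathbb{W}_{t+1}\to\mathbb{R}_+\cup\{+\infty\}$ for $t=0,\dots,T-1$, the final cost $K:\mathbb{X}_T\to\mathbb{R}_+\cup\{+\infty\}$, and $g:\mathbb{X}_T\to\mathbb{R}_+^m$. Inequalities in $\mathbb{R}^m$ are componentwise. $\sigma(\cdot)$ denotes the generated $\sigma$-field; for $t=0$, $\sigma(\mathbf{W}_1,\dots,\mathbf{W}_t)$ is by convention $\{\emptyset,\Omega\}$. $\chi_{\{g(x)-z\le 0\}}(x,z)$ equals $0$ if $g(x)-z\le 0$ and $+\infty$ otherwise. Problem (B) (starting at time $0$): minimize $$\mathbb{E}\Big[\sum_{t=0}^{T-1}L_t(\mathbf{X}_t,\mathbf{U}_t,\mathbf{W}_{t+1})+K(\mathbf{X}_T)\Big]$$ over processes of random variables $(\mathbf{U},\mathbf{V},\mathbf{X},\mathbf{Z})$, with $\mathbf{U}_t$ valued in $\mathbb{U}_t$ and $\mathbf{V}_t$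 valued in $\mathbb{R}^m$ ($t=0,\dots,T-1$), $\mathbf{X}_t$ valued in $\mathbb{X}_t$ and $\mathbf{Z}_t$ valued in $\mathbb{R}^m$ ($t=0,\dots,T$), subject, for all $t=0,\dots,T-1$, to: $\mathbf{X}_0=x_0$, $\mathbf{X}_{t+1}=f_t(\mathbf{X}_t,\mathbf{U}_t,\mathbf{W}_{t+1})$; $\mathbf{Z}_0=z_0$, $\mathbf{Z}_{t+1}=\mathbf{Z}_t+\mathbf{V}_t$; $\sigma(\mathbf{U}_t)\subset\sigma(\mathbf{W}_1,\dots,\mathbf{W}_t)$; $\sigma(\mathbf{V}_t)\subset\sigma(\mathbf{W}_1,\dots,\mathbf{W}_{t+1})$; $\mathbf{V}_t$ is integrable and $\mathbb{E}[\mathbf{V}_t\mid\sigma(\mathbf{W}_1,\dots,\mathbf{W}_t)]=0$; and to the almost sure final constraint $g(\mathbf{X}_T)-\mathbf{Z}_T\le 0$. The symbol $\min$ in the Bellman equation, and the "optimal value" of Problem (B), denote the infimum in $[0,+\infty]$ (equal to $+\infty$ over an empty set). "Can be solved by dynamic programming" means that the optimal value is computed by the backward recursion. *)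

theory Defs
  imports "HOL-Probability.Probability"
begin

text \<open>
  The measurable spaces of the problem are families of measures \<open>XX\<close>, \<open>UU\<close>, \<open>WW\<close> indexed by time,
  of which only the carriers and the sigma-fields matter; all times share one underlying type, and
  the carrier \<open>space (XX t)\<close> may vary with \<open>t\<close>. The sigma-field generated by
  \<open>Y\<close> with values in \<open>N\<close> is \<open>vimage_algebra (space M) Y N\<close>. The order on \<open>real ^ 'm\<close> is the
  library's componentwise order (\<open>less_eq_vec_def\<close>).
\<close>

definition noise_field ::
  "'a measure \<Rightarrow> (nat \<Rightarrow> 'w measure) \<Rightarrow> (nat \<Rightarrow> 'a \<Rightarrow> 'w) \<Rightarrow> nat \<Rightarrow> 'a measure" where
  "noise_field M WW W t =
     sigma (space M) (\<Union>s\<in>{1..t}. sets (vimage_algebra (space M) (W s) (WW s)))"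

lemma sets_noise_field_0: "sets (noise_field M WW W 0) = {{}, space M}"
  by (simp add: noise_field_def sigma_sets_empty_eq)

definition centered_increments ::
  "'a measure \<Rightarrow> 'w measure \<Rightarrow> ('a \<Rightarrow> 'w) \<Rightarrow> ('a \<Rightarrow> real ^ 'm) set" where
  "centered_increments M N Y =
     {V. V \<in> borel_measurable M
       \<and> sets (vimage_algebra (space M) V borel) \<subseteq> sets (vimage_algebra (space M) Y N)
       \<and> integrable M V \<and> (\<integral>\<omega>. V \<omega> \<partial>M) = 0}"

text \<open>
  The library has conditional expectations of real functions only, so
  that of an \<open>real ^ 'm\<close>-valued variable is taken componentwise; being defined up to null sets, it
  vanishes almost everywhere.
\<close>

definition admissible ::
  "'a measure \<Rightarrow> nat \<Rightarrow> (nat \<Rightarrow> 'x measure) \<Rightarrow> (nat \<Rightarrow> 'u measure) \<Rightarrow> (nat \<Rightarrow> 'w measure) \<Rightarrow>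
   (nat \<Rightarrow> 'a \<Rightarrow> 'w) \<Rightarrow> (nat \<Rightarrow> 'x \<times> 'u \<times> 'w \<Rightarrow> 'x) \<Rightarrow> ('x \<Rightarrow> real ^ 'm) \<Rightarrow> 'x \<Rightarrow> real ^ 'm \<Rightarrow>
   (nat \<Rightarrow> 'a \<Rightarrow> 'u) \<Rightarrow> (nat \<Rightarrow> 'a \<Rightarrow> real ^ 'm) \<Rightarrow> (nat \<Rightarrow> 'a \<Rightarrow> 'x) \<Rightarrow> (nat \<Rightarrow> 'a \<Rightarrow> real ^ 'm) \<Rightarrow>
   bool" where
  "admissible M T XX UU WW W f g x0 z0 U V X Z \<longleftrightarrow>
     (\<forall>t<T. U t \<in> M \<rightarrow>\<^sub>M UU t) \<and> (\<forall>t<T. V t \<in> M \<rightarrow>\<^sub>M borel) \<and>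
     (\<forall>t\<le>T. X t \<in> M \<rightarrow>\<^sub>M XX t) \<and> (\<forall>t\<le>T. Z t \<in> M \<rightarrow>\<^sub>M borel) \<and>
     (\<forall>\<omega>\<in>space M. X 0 \<omega> = x0) \<and> (\<forall>\<omega>\<in>space M. Z 0 \<omega> = z0) \<and>
     (\<forall>t<T. \<forall>\<omega>\<in>space M. X (Suc t) \<omega> = f t (X t \<omega>, U t \<omega>, W (Suc t) \<omega>)) \<and>
     (\<forall>t<T. \<forall>\<omega>\<in>space M. Z (Suc t) \<omega> = Z t \<omega> + V t \<omega>) \<and>
     (\<forall>t<T. sets (vimage_algebra (space M) (U t) (UU t)) \<subseteq> sets (noise_field M WW W t)) \<and>
     (\<forall>t<T. sets (vimage_algebra (space M) (V t) borel) \<subseteq> sets (noise_field M WW W (Suc t))) \<and>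
     (\<forall>t<T. integrable M (V t)) \<and>
     (\<forall>t<T. \<forall>i. AE \<omega> in M. real_cond_exp M (noise_field M WW W t) (\<lambda>\<omega>. V t \<omega> $ i) \<omega> = 0) \<and>
     (AE \<omega> in M. g (X T \<omega>) - Z T \<omega> \<le> 0)"

definition expected_cost ::
  "'a measure \<Rightarrow> nat \<Rightarrow> (nat \<Rightarrow> 'a \<Rightarrow> 'w) \<Rightarrow> (nat \<Rightarrow> 'x \<times> 'u \<times> 'w \<Rightarrow> ennreal) \<Rightarrow> ('x \<Rightarrow> ennreal) \<Rightarrow>
   (nat \<Rightarrow> 'a \<Rightarrow> 'u) \<Rightarrow> (nat \<Rightarrow> 'a \<Rightarrow> 'x) \<Rightarrow> ennreal" where
  "expected_cost M T W L K U X =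
     (\<integral>\<^sup>+ \<omega>. (\<Sum>t<T. L t (X t \<omega>, U t \<omega>, W (Suc t) \<omega>)) + K (X T \<omega>) \<partial>M)"

definition optimal_value ::
  "'a measure \<Rightarrow> nat \<Rightarrow> (nat \<Rightarrow> 'x measure) \<Rightarrow> (nat \<Rightarrow> 'u measure) \<Rightarrow> (nat \<Rightarrow> 'w measure) \<Rightarrow>
   (nat \<Rightarrow> 'a \<Rightarrow> 'w) \<Rightarrow> (nat \<Rightarrow> 'x \<times> 'u \<times> 'w \<Rightarrow> 'x) \<Rightarrow> (nat \<Rightarrow> 'x \<times> 'u \<times> 'w \<Rightarrow> ennreal) \<Rightarrow>
   ('x \<Rightarrow> ennreal) \<Rightarrow> ('x \<Rightarrow> real ^ 'm) \<Rightarrow> 'x \<Rightarrow> real ^ 'm \<Rightarrow> ennreal" where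
  "optimal_value M T XX UU WW W f L K g x0 z0 =
     Inf {expected_cost M T W L K U X | U V X Z. admissible M T XX UU WW W f g x0 z0 U V X Z}"

end

theory Submission
  imports Defs
begin

text \<open>
  Since the noise takes finitely many values, every sigma-field \<open>F t\<close> generated by the first \<open>t\<close>
  noises is finite, and it is described by its atoms. On an atom \<open>A\<close> of \<open>F t\<close> the state and the
  control are constant up to points that measurable functions cannot separate, and an
  \<open>F (t + 1)\<close>-measurable increment agrees with a function of the next noise alone. By
  independence, the integral over \<open>A\<close> of the stage cost plus the next value function is then the
  probability of \<open>A\<close> times the expectation in the Bellman equation. Summing over atoms, one step of
  an admissible process never beats the value function; choosing an almost optimal decision for
  every atom attains it up to an arbitrary error.
\<close>

section \<open>Atoms of finite sigma-fields\<close>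

text \<open>The final constraint is never imposed while a process is being built. It acts through
  the infinite penalty in the terminal value: a process of finite truncated cost satisfies the
  constraint almost surely, and this is how the near optimal process becomes admissible. An infinite
  initial value makes the upper bound trivial; a finite one forces all control sets to be nonempty,
  without which no process exists. The martingale condition is met from two sides. For the lower
  bound, an increment restricted to one atom must be extended to a centered function of the next
  noise; its mean is controlled on atoms of positive probability, and null atoms contribute nothing.
  For the upper bound, one centered function per atom is glued into an increment, finiteness giving
  measurability and integrability. Both bounds compare successive terms of one sequence, from the
  initial value to the cost.\<close>

definition atom :: "'a measure \<Rightarrow> 'a \<Rightarrow> 'a set" where
  "atom N \<omega> = \<Inter>{B \<in> sets N. \<omega> \<in> B}"

lemma atom_memD: "\<omega>' \<in> atom N \<omega> \<Longrightarrow> B \<in> sets N \<Longrightarrow> \<omega> \<in> B \<Longrightarrow> \<omega>' \<in> B"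
  by (auto simp: atom_def)

lemma atom_self: "\<omega> \<in> atom N \<omega>"
  by (auto simp: atom_def)

text \<open>A point outside \<open>space N\<close> lies in no measurable set, so its
  \<open>atom\<close> is the intersection of an empty family, the whole type; hence the recurring
  space hypothesis.\<close>

lemma atom_subset_space: "\<omega> \<in> space N \<Longrightarrow> atom N \<omega> \<subseteq> space N"
  by (auto simp: atom_def)

lemma sets_atom:
  assumes "finite (sets N)" "\<omega> \<in> space N"
  shows "atom N \<omega> \<in> sets N"
proof -
  have "(\<Inter>B\<in>{B \<in> sets N. \<omega> \<in> B}. B) \<in> sets N"
    using assms by (intro sets.finite_INT) auto
  then show ?thesis by (simp add: atom_def)
qed

text \<open>Complements of measurable sets are measurable, so the one-sided definition of an atom
  already gives indistinguishability in both directions.\<close>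

lemma atom_separation:
  assumes "\<omega> \<in> space N" "\<omega>' \<in> atom N \<omega>" "B \<in> sets N"
  shows "\<omega>' \<in> B \<longleftrightarrow> \<omega> \<in> B"
proof
  assume "\<omega>' \<in> B"
  show "\<omega> \<in> B"
  proof (rule ccontr)
    assume "\<omega> \<notin> B"
    then have "\<omega>' \<in> space N - B"
      using assms by (intro atom_memD[OF assms(2)]) auto
    with \<open>\<omega>' \<in> B\<close> show False by simp
  qed
qed (rule atom_memD[OF assms(2,3)])

lemma atom_eq:
  assumes "\<omega> \<in> space N" "\<omega>' \<in> atom N \<omega>"
  shows "atom N \<omega>' = atom N \<omega>"
proof -
  have "{B \<in> sets N. \<omega>' \<in> B} = {B \<in> sets N. \<omega> \<in> B}"
    by (rule Collect_cong) (use atom_separation[OF assms] in blast)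
  then show ?thesis by (simp only: atom_def)
qed

text \<open>In a T1 space singletons are Borel, so the fibre of \<open>h\<close> through
  \<open>\<omega>\<close> is a measurable set containing \<open>\<omega>\<close>. For a coarser
  sigma-field on the target the conclusion may fail.\<close>

lemma measurable_const_on_atom:
  fixes h :: "'a \<Rightarrow> 'b :: t1_space"
  assumes "h \<in> N \<rightarrow>\<^sub>M borel" "\<omega> \<in> space N" "\<omega>' \<in> atom N \<omega>"
  shows "h \<omega>' = h \<omega>"
proof -
  have "h -` {h \<omega>} \<inter> space N \<in> sets N"
    using assms by (intro measurable_sets) auto
  from atom_separation[OF assms(2,3) this] show ?thesis using assms(2) by simp
qed

text \<open>Preimages under such an \<open>h\<close> are unions of atoms, of which a finite
  sigma-field has finitely many. The target sigma-field is arbitrary, so this also produces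
  controls.\<close>

lemma measurable_if_const_on_atoms:
  assumes "finite (sets N)" and "h \<in> space N \<rightarrow> space S"
    and "\<And>\<omega> \<omega>'. \<omega> \<in> space N \<Longrightarrow> \<omega>' \<in> atom N \<omega> \<Longrightarrow> h \<omega>' = h \<omega>"
  shows "h \<in> N \<rightarrow>\<^sub>M S"
proof (rule measurableI)
  fix B assume "B \<in> sets S"
  have "h -` B \<inter> space N = \<Union>(atom N ` (h -` B \<inter> space N))"
  proof (intro equalityI subsetI)
    fix \<omega>' assume "\<omega>' \<in> \<Union>(atom N ` (h -` B \<inter> space N))"
    then obtain \<omega> where \<omega>: "\<omega> \<in> space N" "h \<omega> \<in> B" "\<omega>' \<in> atom N \<omega>" by auto
    with assms(3)[OF \<omega>(1,3)] atom_subset_space[OF \<omega>(1)] show "\<omega>' \<in> h -` B \<inter> space N" by auto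
  qed (auto intro: atom_self)
  also have "\<dots> \<in> sets N"
  proof (rule sets.finite_Union)
    show sub: "atom N ` (h -` B \<inter> space N) \<subseteq> sets N"
      using sets_atom[OF assms(1)] by auto
    show "finite (atom N ` (h -` B \<inter> space N))"
      using finite_subset[OF sub assms(1)] .
  qed
  finally show "h -` B \<inter> space N \<in> sets N" .
qed (use assms(2) in auto)

text \<open>For two fixed points, the sets that do not separate them are closed under complement and
  countable union.\<close>

lemma sigma_sets_inseparable:
  assumes "B \<in> sigma_sets \<Omega> E" "\<omega> \<in> \<Omega>" "\<omega>' \<in> \<Omega>"
    and "\<And>C. C \<in> E \<Longrightarrow> \<omega> \<in> C \<longleftrightarrow> \<omega>' \<in> C"
  shows "\<omega> \<in> B \<longleftrightarrow> \<omega>' \<in> B"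
  using assms(1) by induction (use assms in auto)

definition atoms :: "'a measure \<Rightarrow> 'a set set" where
  "atoms N = atom N ` space N"

text \<open>The chosen point depends on the set alone and is therefore common to all points of an
  atom.\<close>

definition representative :: "'a set \<Rightarrow> 'a" where
  "representative A = (SOME \<omega>. \<omega> \<in> A)"

lemma finite_atoms: "finite (sets N) \<Longrightarrow> finite (atoms N)"
  unfolding atoms_def using sets_atom by (metis finite_subset image_subsetI)

lemma atoms_sets: "finite (sets N) \<Longrightarrow> A \<in> atoms N \<Longrightarrow> A \<in> sets N"
  unfolding atoms_def using sets_atom by auto

lemma representative_atom: "representative (atom N \<omega>) \<in> atom N \<omega>"
  unfolding representative_def using atom_self by (metis someI)

lemma mem_atoms_iff:
  assumes "A \<in> atoms N" "\<omega> \<in> space N"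
  shows "\<omega> \<in> A \<longleftrightarrow> A = atom N \<omega>"
proof
  assume "\<omega> \<in> A"
  from assms(1) obtain \<omega>' where "\<omega>' \<in> space N" "A = atom N \<omega>'" by (auto simp: atoms_def)
  then show "A = atom N \<omega>" using atom_eq \<open>\<omega> \<in> A\<close> by metis
qed (simp add: atom_self)

lemma sum_atoms_single:
  fixes h :: "'a set \<Rightarrow> 'b :: comm_monoid_add"
  assumes "finite (sets N)" "\<omega> \<in> space N"
    and "\<And>A. A \<in> atoms N \<Longrightarrow> \<omega> \<notin> A \<Longrightarrow> h A = 0"
  shows "sum h (atoms N) = h (atom N \<omega>)"
proof -
  have "sum h (atoms N) = (\<Sum>A\<in>atoms N. if A = atom N \<omega> then h A else 0)"
    using assms(2,3) by (intro sum.cong refl) (auto simp: mem_atoms_iff)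
  also have "\<dots> = h (atom N \<omega>)"
    using assms(2) finite_atoms[OF assms(1)] by (subst sum.delta) (auto simp: atoms_def)
  finally show ?thesis .
qed

text \<open>The atoms form a finite measurable partition, so both integrals split. The integrands
  may vary within an atom, as a stage cost does with the next noise.\<close>

lemma nn_integral_mono_atoms:
  assumes "subalgebra M N" "finite (sets N)"
    and "h \<in> borel_measurable M" "k \<in> borel_measurable M"
    and le: "\<And>\<omega>. \<omega> \<in> space M \<Longrightarrow>
      (\<integral>\<^sup>+\<omega>'. h \<omega>' * indicator (atom N \<omega>) \<omega>' \<partial>M) \<le> (\<integral>\<^sup>+\<omega>'. k \<omega>' * indicator (atom N \<omega>) \<omega>' \<partial>M)"
  shows "(\<integral>\<^sup>+\<omega>. h \<omega> \<partial>M) \<le> (\<integral>\<^sup>+\<omega>. k \<omega> \<partial>M)"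
proof -
  have sp: "space N = space M" using assms by (simp add: subalgebra_def)
  have sM: "A \<in> sets M" if "A \<in> atoms N" for A
    using atoms_sets[OF assms(2) that] assms(1) by (auto simp: subalgebra_def)
  have split: "(\<integral>\<^sup>+\<omega>. q \<omega> \<partial>M) = (\<Sum>A\<in>atoms N. \<integral>\<^sup>+\<omega>. q \<omega> * indicator A \<omega> \<partial>M)"
    if "q \<in> borel_measurable M" for q :: "'a \<Rightarrow> ennreal"
  proof -
    have "(\<integral>\<^sup>+\<omega>. q \<omega> \<partial>M) = (\<integral>\<^sup>+\<omega>. (\<Sum>A\<in>atoms N. q \<omega> * indicator A \<omega>) \<partial>M)"
      by (intro nn_integral_cong) (subst sum_atoms_single[OF assms(2)], auto simp: sp atom_self)
    also have "\<dots> = (\<Sum>A\<in>atoms N. \<integral>\<^sup>+\<omega>. q \<omega> * indicator A \<omega> \<partial>M)"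
      using that sM by (intro nn_integral_sum) auto
    finally show ?thesis .
  qed
  show ?thesis
    unfolding split[OF assms(3)] split[OF assms(4)]
    by (intro sum_mono) (auto simp: atoms_def sp intro: le)
qed

text \<open>Bridges the inclusions of generated sigma-fields, in which the information constraints
  are stated, and measurability.\<close>

lemma measurable_iff_vimage_algebra_subset:
  assumes "h \<in> space F \<rightarrow> space S"
  shows "h \<in> F \<rightarrow>\<^sub>M S \<longleftrightarrow> sets (vimage_algebra (space F) h S) \<subseteq> sets F"
  using assms by (auto simp: sets_vimage_algebra2 measurable_def)

lemma finite_sets_if_subset:
  assumes "finite (Y ` \<Omega>)" "sets N \<subseteq> range (\<lambda>C. Y -` C \<inter> \<Omega>)"
  shows "finite (sets N)"
proof (rule finite_subset)
  show "sets N \<subseteq> (\<lambda>C. Y -` C \<inter> \<Omega>) ` Pow (Y ` \<Omega>)"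
  proof
    fix B assume "B \<in> sets N"
    then obtain C where "B = Y -` C \<inter> \<Omega>" using assms(2) by auto
    then have "B = Y -` (C \<inter> Y ` \<Omega>) \<inter> \<Omega>" by auto
    then show "B \<in> (\<lambda>C. Y -` C \<inter> \<Omega>) ` Pow (Y ` \<Omega>)" by blast
  qed
qed (use assms(1) in auto)

section \<open>Integration over an event independent of a sigma-field\<close>

context prob_space
begin

text \<open>Independence says exactly that the densities \<open>indicator A\<close> and constant
  \<open>prob A\<close> define measures agreeing on \<open>G\<close>. Equality of measures then
  serves nonnegative and Bochner integrals alike.\<close>

lemma restr_density_eq_of_indep:
  assumes G: "subalgebra M G" and A: "A \<in> sets M"
    and ind: "\<And>B. B \<in> sets G \<Longrightarrow> prob (A \<inter> B) = prob A * prob B"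
  defines "N1 \<equiv> density M (\<lambda>\<omega>. ennreal (indicator A \<omega>))"
    and "N2 \<equiv> density M (\<lambda>\<omega>. ennreal (prob A))"
  shows "subalgebra N1 G" "subalgebra N2 G" "restr_to_subalg N1 G = restr_to_subalg N2 G"
proof -
  show 1: "subalgebra N1 G" and 2: "subalgebra N2 G"
    using G by (auto simp: subalgebra_def N1_def N2_def)
  show "restr_to_subalg N1 G = restr_to_subalg N2 G"
  proof (rule measure_eqI)
    fix B assume "B \<in> sets (restr_to_subalg N1 G)"
    then have B: "B \<in> sets G" using sets_restr_to_subalg[OF 1] by simp
    then have BM: "B \<in> sets M" using G by (auto simp: subalgebra_def)
    have "emeasure N1 B = (\<integral>\<^sup>+\<omega>. indicator (A \<inter> B) \<omega> \<partial>M)"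
      unfolding N1_def using A BM
      by (subst emeasure_density)
        (auto simp del: nn_integral_indicator intro!: nn_integral_cong simp: indicator_def)
    also have "\<dots> = emeasure N2 B"
      unfolding N2_def using A BM ind[OF B]
      by (subst emeasure_density)
        (auto simp: nn_integral_cmult emeasure_eq_measure ennreal_mult)
    finally show "emeasure (restr_to_subalg N1 G) B = emeasure (restr_to_subalg N2 G) B"
      using B by (simp add: emeasure_restr_to_subalg[OF 1] emeasure_restr_to_subalg[OF 2])
  qed (simp add: sets_restr_to_subalg[OF 1] sets_restr_to_subalg[OF 2])
qed

lemma nn_integral_indicator_indep:
  assumes G: "subalgebra M G" and A: "A \<in> sets M"
    and ind: "\<And>B. B \<in> sets G \<Longrightarrow> prob (A \<inter> B) = prob A * prob B"
    and h: "h \<in> borel_measurable G"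
  shows "(\<integral>\<^sup>+\<omega>. h \<omega> * indicator A \<omega> \<partial>M) = emeasure M A * (\<integral>\<^sup>+\<omega>. h \<omega> \<partial>M)"
proof -
  note r = restr_density_eq_of_indep[OF G A ind]
  have hM: "h \<in> borel_measurable M" using measurable_from_subalg[OF G h] .
  have "(\<integral>\<^sup>+\<omega>. h \<omega> * indicator A \<omega> \<partial>M) = (\<integral>\<^sup>+\<omega>. h \<omega> \<partial>density M (\<lambda>\<omega>. ennreal (indicator A \<omega>)))"
    using hM A by (subst nn_integral_density) (auto intro!: nn_integral_cong simp: indicator_def)
  also have "\<dots> = (\<integral>\<^sup>+\<omega>. h \<omega> \<partial>density M (\<lambda>\<omega>. ennreal (prob A)))"
    using nn_integral_subalgebra2[OF r(1) h] nn_integral_subalgebra2[OF r(2) h] r(3) by simp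
  also have "\<dots> = emeasure M A * (\<integral>\<^sup>+\<omega>. h \<omega> \<partial>M)"
    using hM by (subst nn_integral_density) (auto simp: nn_integral_cmult emeasure_eq_measure)
  finally show ?thesis .
qed

lemma integral_indicator_indep:
  fixes h :: "'a \<Rightarrow> 'b :: {banach, second_countable_topology}"
  assumes G: "subalgebra M G" and A: "A \<in> sets M"
    and ind: "\<And>B. B \<in> sets G \<Longrightarrow> prob (A \<inter> B) = prob A * prob B"
    and h: "h \<in> borel_measurable G"
  shows "(\<integral>\<omega>. indicator A \<omega> *\<^sub>R h \<omega> \<partial>M) = prob A *\<^sub>R (\<integral>\<omega>. h \<omega> \<partial>M)"
proof -
  note r = restr_density_eq_of_indep[OF G A ind]
  have hM: "h \<in> borel_measurable M" using measurable_from_subalg[OF G h] .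
  have "(\<integral>\<omega>. indicator A \<omega> *\<^sub>R h \<omega> \<partial>M) = (\<integral>\<omega>. h \<omega> \<partial>density M (\<lambda>\<omega>. ennreal (indicator A \<omega>)))"
    using hM A by (subst integral_density) auto
  also have "\<dots> = (\<integral>\<omega>. h \<omega> \<partial>density M (\<lambda>\<omega>. ennreal (prob A)))"
    using integral_subalgebra2[OF r(1) h] integral_subalgebra2[OF r(2) h] r(3) by simp
  also have "\<dots> = prob A *\<^sub>R (\<integral>\<omega>. h \<omega> \<partial>M)"
    using hM by (subst integral_density) auto
  finally show ?thesis .
qed

text \<open>Such an \<open>h\<close> takes one value per atom, hence finitely many values, and is
  bounded.\<close>

lemma integrable_finite_subalgebra:
  fixes h :: "'a \<Rightarrow> 'b :: {banach, second_countable_topology}"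
  assumes "subalgebra M N" "finite (sets N)" "h \<in> borel_measurable N"
  shows "integrable M h"
proof -
  let ?R = "(\<lambda>A. h (representative A)) ` atoms N"
  have sp: "space N = space M" using assms by (simp add: subalgebra_def)
  have "h \<omega> \<in> ?R" if "\<omega> \<in> space M" for \<omega>
    using that sp measurable_const_on_atom[OF assms(3) _ representative_atom, of \<omega>]
    by (metis atoms_def imageI)
  then have "norm (h \<omega>) \<le> Max (norm ` ?R)" if "\<omega> \<in> space M" for \<omega>
    using that finite_atoms[OF assms(2)] by (intro Max_ge) auto
  then show ?thesis
    using measurable_from_subalg[OF assms(1,3)] by (intro integrable_const_bound) auto
qed

end

section \<open>Filtrations of finite independent noises\<close>

locale finite_noise = prob_space M for M :: "'a measure" +
  fixes T :: nat and WW :: "nat \<Rightarrow> 'w measure" and W :: "nat \<Rightarrow> 'a \<Rightarrow> 'w"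
  assumes measurable_noise: "\<And>t. t \<in> {1..T} \<Longrightarrow> W t \<in> M \<rightarrow>\<^sub>M WW t"
    and indep_noise: "indep_vars WW W {1..T}"
    and finite_noise: "finite ((\<lambda>\<omega>. \<lambda>t\<in>{1..T}. W t \<omega>) ` space M)"
begin

abbreviation F :: "nat \<Rightarrow> 'a measure" where
  "F t \<equiv> noise_field M WW W t"

abbreviation G :: "nat \<Rightarrow> 'a measure" where
  "G t \<equiv> vimage_algebra (space M) (W t) (WW t)"

lemma sets_G: "t \<in> {1..T} \<Longrightarrow> sets (G t) = {W t -` B \<inter> space M | B. B \<in> sets (WW t)}"
  by (intro sets_vimage_algebra2) (use measurable_space[OF measurable_noise] in blast)

lemma F_generators: "(\<Union>s\<in>{1..t}. sets (G s)) \<subseteq> Pow (space M)"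
  using sets.space_closed by fastforce

lemma space_F [simp]: "space (F t) = space M"
  unfolding noise_field_def using F_generators by (rule space_measure_of)

lemma sets_F: "sets (F t) = sigma_sets (space M) (\<Union>s\<in>{1..t}. sets (G s))"
  unfolding noise_field_def using F_generators by (rule sets_measure_of)

lemma subalgebra_G: "t \<in> {1..T} \<Longrightarrow> subalgebra M (G t)"
  using sets_G measurable_sets[OF measurable_noise] by (auto simp: subalgebra_def)

lemma subalgebra_F:
  assumes "t \<le> T"
  shows "subalgebra M (F t)"
proof -
  have "(\<Union>s\<in>{1..t}. sets (G s)) \<subseteq> sets M"
    using assms subalgebra_G by (fastforce simp: subalgebra_def)
  then show ?thesis
    unfolding subalgebra_def sets_F by (simp add: sets.sigma_sets_subset)
qed

lemma subalgebra_F_Suc: "subalgebra (F (Suc t)) (F t)"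
proof -
  have "(\<Union>s\<in>{1..t}. sets (G s)) \<subseteq> (\<Union>s\<in>{1..Suc t}. sets (G s))"
    by (intro UN_mono) auto
  then show ?thesis unfolding subalgebra_def sets_F by (simp add: sigma_sets_mono')
qed

lemma subalgebra_F_G: "subalgebra (F (Suc t)) (G (Suc t))"
proof -
  have "sets (G (Suc t)) \<subseteq> (\<Union>s\<in>{1..Suc t}. sets (G s))"
    by (intro UN_upper) auto
  then show ?thesis unfolding subalgebra_def sets_F by (auto intro: sigma_sets.Basic)
qed

text \<open>\<open>F t\<close> is coarser than the family of all preimages under the noise tuple,
  which is a sigma-field (the one pulled back from the discrete target) and is finite because the
  tuple has finitely many values.\<close>

lemma finite_F:
  assumes "t \<le> T"
  shows "finite (sets (F t))"
proof (rule finite_sets_if_subset[OF finite_noise])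
  let ?Y = "\<lambda>\<omega>. \<lambda>t\<in>{1..T}. W t \<omega>"
  let ?V = "vimage_algebra (space M) ?Y (count_space UNIV)"
  have V: "sets ?V = range (\<lambda>C. ?Y -` C \<inter> space M)"
    by (subst sets_vimage_algebra2) auto
  have "(\<Union>s\<in>{1..t}. sets (G s)) \<subseteq> sets ?V"
  proof
    fix B assume "B \<in> (\<Union>s\<in>{1..t}. sets (G s))"
    then obtain s C where "s \<in> {1..T}" "B = W s -` C \<inter> space M"
      using assms sets_G by fastforce
    then have "B = ?Y -` {y. y s \<in> C} \<inter> space M" by auto
    then show "B \<in> sets ?V" unfolding V by blast
  qed
  then have "sets (F t) \<subseteq> sets ?V"
    unfolding sets_F using sets.sigma_sets_subset[of "\<Union>s\<in>{1..t}. sets (G s)" ?V] by simp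
  then show "sets (F t) \<subseteq> range (\<lambda>C. ?Y -` C \<inter> space M)" unfolding V .
qed

lemma finite_G: "t < T \<Longrightarrow> finite (sets (G (Suc t)))"
  using finite_F[of "Suc t"] subalgebra_F_G[of t] by (auto simp: subalgebra_def intro: finite_subset)

lemma measurable_F_Suc: "h \<in> F t \<rightarrow>\<^sub>M N \<Longrightarrow> h \<in> F (Suc t) \<rightarrow>\<^sub>M N"
  by (rule measurable_from_subalg[OF subalgebra_F_Suc])

lemma measurable_F_M: "h \<in> F t \<rightarrow>\<^sub>M N \<Longrightarrow> t \<le> T \<Longrightarrow> h \<in> M \<rightarrow>\<^sub>M N"
  by (rule measurable_from_subalg[OF subalgebra_F])

lemma measurable_noise_G: "t < T \<Longrightarrow> W (Suc t) \<in> G (Suc t) \<rightarrow>\<^sub>M WW (Suc t)"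
  by (intro measurable_vimage_algebra1) (use measurable_space[OF measurable_noise] in auto)

lemma measurable_noise_F: "t < T \<Longrightarrow> W (Suc t) \<in> F (Suc t) \<rightarrow>\<^sub>M WW (Suc t)"
  by (rule measurable_from_subalg[OF subalgebra_F_G measurable_noise_G])

text \<open>Each generator of \<open>F (Suc t)\<close> belongs to \<open>F t\<close> or to
  \<open>G (Suc t)\<close>, and neither of these separates the two points.\<close>

lemma atom_F_Suc:
  assumes "\<omega> \<in> space M" "\<omega>' \<in> atom (F t) \<omega>" "\<omega>' \<in> atom (G (Suc t)) \<omega>"
  shows "\<omega>' \<in> atom (F (Suc t)) \<omega>"
  unfolding atom_def
proof safe
  fix B assume B: "B \<in> sets (F (Suc t))" "\<omega> \<in> B"
  have \<omega>': "\<omega>' \<in> space M" using atom_subset_space[of \<omega> "F t"] assms by auto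
  have "\<omega> \<in> B \<longleftrightarrow> \<omega>' \<in> B"
  proof (rule sigma_sets_inseparable[OF B(1)[unfolded sets_F] assms(1) \<omega>'])
    fix C assume "C \<in> (\<Union>s\<in>{1..Suc t}. sets (G s))"
    then obtain s where s: "s \<in> {1..Suc t}" "C \<in> sets (G s)" by blast
    show "\<omega> \<in> C \<longleftrightarrow> \<omega>' \<in> C"
    proof (cases "s = Suc t")
      case True
      with s atom_separation[OF _ assms(3), of C] assms(1) show ?thesis by auto
    next
      case False
      with s have "C \<in> sets (F t)" unfolding sets_F by (intro sigma_sets.Basic) auto
      with atom_separation[OF _ assms(2), of C] assms(1) show ?thesis by auto
    qed
  qed
  with B show "\<omega>' \<in> B" by simp
qed

text \<open>Grouping of independent families: the index blocks \<open>{1..t}\<close> and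
  \<open>{Suc t}\<close> are disjoint, and the preimages under each noise are stable under
  intersection.\<close>

lemma indep_F_G:
  assumes "t < T" "A \<in> sets (F t)" "B \<in> sets (G (Suc t))"
  shows "prob (A \<inter> B) = prob A * prob B"
proof -
  let ?I = "case_bool {1..t} {Suc t}"
  let ?E = "\<lambda>s. {W s -` B \<inter> space M | B. B \<in> sets (WW s)}"
  have "indep_sets (\<lambda>j. sigma_sets (space M) (\<Union>i\<in>?I j. ?E i)) UNIV"
  proof (rule indep_sets_collect_sigma)
    have "indep_sets ?E {1..T}" using indep_noise by (simp add: indep_vars_def2)
    then show "indep_sets ?E (\<Union>j\<in>UNIV. ?I j)"
      by (rule indep_sets_mono_index[rotated]) (use assms(1) in \<open>auto split: bool.splits\<close>)
    show "disjoint_family_on ?I UNIV"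
      by (auto simp: disjoint_family_on_def split: bool.splits)
    fix i show "Int_stable (?E i)"
    proof (rule Int_stableI)
      fix a b assume "a \<in> ?E i" "b \<in> ?E i"
      then obtain A B where "A \<in> sets (WW i)" "B \<in> sets (WW i)"
        "a = W i -` A \<inter> space M" "b = W i -` B \<inter> space M" by blast
      then show "a \<inter> b \<in> ?E i" by (intro CollectI exI[of _ "A \<inter> B"]) auto
    qed
  qed
  also have "(\<lambda>j. sigma_sets (space M) (\<Union>i\<in>?I j. ?E i))
      = case_bool (sets (F t)) (sets (G (Suc t)))"
  proof
    fix j
    have "(\<Union>s\<in>{1..t}. ?E s) = (\<Union>s\<in>{1..t}. sets (G s))"
      using assms(1) sets_G by (intro SUP_cong) auto
    moreover have "sigma_sets (space M) (?E (Suc t)) = sets (G (Suc t))"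
      by (simp add: sets_vimage_algebra)
    ultimately show "sigma_sets (space M) (\<Union>i\<in>?I j. ?E i)
        = case_bool (sets (F t)) (sets (G (Suc t))) j"
      by (simp add: sets_F split: bool.split)
  qed
  finally have "indep_set (sets (F t)) (sets (G (Suc t)))" by (simp add: indep_set_def)
  from indep_setD[OF this assms(2,3)] show ?thesis .
qed

section \<open>Centered increments and vanishing conditional expectations\<close>

lemma centered_increments_iff:
  assumes "s \<in> {1..T}"
  shows "V \<in> centered_increments M (WW s) (W s) \<longleftrightarrow>
    V \<in> borel_measurable (G s) \<and> integrable M V \<and> (\<integral>\<omega>. V \<omega> \<partial>M) = 0"
  using measurable_iff_vimage_algebra_subset[of V "G s" borel]
  by (auto simp: centered_increments_def)

lemma zero_centered: "s \<in> {1..T} \<Longrightarrow> (\<lambda>_. 0) \<in> centered_increments M (WW s) (W s)"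
  by (simp add: centered_increments_iff)

text \<open>The defining property of conditional expectation, coordinate by coordinate. Everything
  that follows uses the martingale condition in this integrated form, which can be tested on single
  atoms.\<close>

lemma cond_exp_zero_iff:
  fixes V :: "'a \<Rightarrow> real ^ 'm"
  assumes "t \<le> T" and V: "integrable M V"
  shows "(\<forall>i. AE \<omega> in M. real_cond_exp M (F t) (\<lambda>\<omega>. V \<omega> $ i) \<omega> = 0) \<longleftrightarrow>
    (\<forall>A\<in>sets (F t). (\<integral>\<omega>. indicator A \<omega> *\<^sub>R V \<omega> \<partial>M) = 0)"
proof -
  interpret S: sigma_finite_subalgebra M "F t"
    by (intro finite_measure_subalgebra_is_sigma_finite finite_measure_subalgebra.intro
        finite_measure_axioms finite_measure_subalgebra_axioms.intro subalgebra_F assms)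
  have AM: "A \<in> sets M" if "A \<in> sets (F t)" for A
    using that subalgebra_F[OF assms(1)] by (auto simp: subalgebra_def)
  have Vi: "integrable M (\<lambda>\<omega>. V \<omega> $ i)" for i
    using integrable_bounded_linear[OF bounded_linear_vec_nth V] .
  have comp: "(\<integral>\<omega>. indicator A \<omega> *\<^sub>R V \<omega> \<partial>M) $ i = (\<integral>\<omega>\<in>A. V \<omega> $ i \<partial>M)"
    if "A \<in> sets (F t)" for A i
  proof -
    have "integrable M (\<lambda>\<omega>. indicator A \<omega> *\<^sub>R V \<omega>)"
      using integrable_mult_indicator[OF AM[OF that] V] .
    from integral_bounded_linear[OF bounded_linear_vec_nth this, of i] show ?thesis
      by (simp add: set_lebesgue_integral_def)
  qed
  show ?thesis
  proof safe
    fix A assume 0: "\<forall>i. AE \<omega> in M. real_cond_exp M (F t) (\<lambda>\<omega>. V \<omega> $ i) \<omega> = 0"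
      and A: "A \<in> sets (F t)"
    have "(\<integral>\<omega>\<in>A. V \<omega> $ i \<partial>M) = 0" for i
    proof -
      have "(\<integral>\<omega>\<in>A. V \<omega> $ i \<partial>M) = (\<integral>\<omega>\<in>A. real_cond_exp M (F t) (\<lambda>\<omega>. V \<omega> $ i) \<omega> \<partial>M)"
        by (rule S.real_cond_exp_intA[OF Vi A])
      also have "\<dots> = 0"
        unfolding set_lebesgue_integral_def
        using 0[rule_format, of i] by (intro integral_eq_zero_AE) auto
      finally show ?thesis .
    qed
    then show "(\<integral>\<omega>. indicator A \<omega> *\<^sub>R V \<omega> \<partial>M) = 0"
      by (simp add: vec_eq_iff comp[OF A])
  next
    fix i assume 0: "\<forall>A\<in>sets (F t). (\<integral>\<omega>. indicator A \<omega> *\<^sub>R V \<omega> \<partial>M) = 0"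
    show "AE \<omega> in M. real_cond_exp M (F t) (\<lambda>\<omega>. V \<omega> $ i) \<omega> = 0"
    proof (rule S.real_cond_exp_charact[OF _ Vi])
      fix A assume A: "A \<in> sets (F t)"
      then show "(\<integral>\<omega>\<in>A. V \<omega> $ i \<partial>M) = (\<integral>\<omega>\<in>A. 0 \<partial>M)"
        using 0 comp[OF A, of i] by simp
    qed auto
  qed
qed

text \<open>Independence turns the vanishing conditional expectation of \<open>V\<close> on an atom of positive
  probability into the vanishing expectation of a single function of the next noise.\<close>

lemma centered_extension:
  fixes V :: "'a \<Rightarrow> real ^ 'm"
  assumes t: "t < T" and V: "V \<in> borel_measurable (F (Suc t))"
    and 0: "\<And>A. A \<in> sets (F t) \<Longrightarrow> (\<integral>\<omega>. indicator A \<omega> *\<^sub>R V \<omega> \<partial>M) = 0"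
    and \<omega>0: "\<omega>0 \<in> space M" and pos: "prob (atom (F t) \<omega>0) \<noteq> 0"
  obtains V' where "V' \<in> centered_increments M (WW (Suc t)) (W (Suc t))"
    and "\<And>\<omega>. \<omega> \<in> atom (F t) \<omega>0 \<Longrightarrow> V' \<omega> = V \<omega>"
proof -
  let ?A = "atom (F t) \<omega>0" and ?G = "G (Suc t)"
  have G: "subalgebra M ?G" using t by (intro subalgebra_G) auto
  have A: "?A \<in> sets (F t)" using t \<omega>0 by (intro sets_atom finite_F) auto
  then have AM: "?A \<in> sets M"
    using subalgebra_F[of t] t by (auto simp: subalgebra_def)
  \<comment> \<open>On \<open>?A\<close> the value of \<open>V\<close> depends only on the atom of
    \<open>?G\<close>, so any point of \<open>?A\<close> in that atom may supply it. Atoms of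
    \<open>?G\<close> that miss \<open>?A\<close> are null by independence, since \<open>?A\<close>
    has positive probability, so the default 0 does not affect the mean.\<close>
  define V' where "V' \<omega> = (if ?A \<inter> atom ?G \<omega> = {} then 0
    else V (representative (?A \<inter> atom ?G \<omega>)))" for \<omega>
  have V'_G: "V' \<in> borel_measurable ?G"
  proof (rule measurable_if_const_on_atoms)
    fix \<omega> \<omega>' assume "\<omega> \<in> space ?G" "\<omega>' \<in> atom ?G \<omega>"
    then have "atom ?G \<omega>' = atom ?G \<omega>" by (rule atom_eq)
    then show "V' \<omega>' = V' \<omega>" by (simp add: V'_def)
  qed (use t in \<open>auto intro: finite_G\<close>)
  have V'_eq: "V' \<omega> = V \<omega>" if \<omega>: "\<omega> \<in> ?A" for \<omega>
  proof -
    have \<omega>M: "\<omega> \<in> space M" using \<omega> atom_subset_space[of \<omega>0 "F t"] \<omega>0 by auto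
    let ?\<omega>' = "representative (?A \<inter> atom ?G \<omega>)"
    have mem: "\<omega> \<in> ?A \<inter> atom ?G \<omega>" using \<omega> atom_self by auto
    then have "?\<omega>' \<in> ?A \<inter> atom ?G \<omega>" unfolding representative_def by (rule someI)
    \<comment> \<open>Recentering \<open>?A\<close> at \<open>\<omega>\<close> gives both atoms the
      same base point, as \<open>atom_F_Suc\<close> requires.\<close>
    moreover have "?A = atom (F t) \<omega>" using atom_eq[of \<omega>0 "F t" \<omega>] \<omega>0 \<omega> by simp
    ultimately have "?\<omega>' \<in> atom (F (Suc t)) \<omega>"
      using \<omega>M by (intro atom_F_Suc) auto
    then have "V ?\<omega>' = V \<omega>"
      using \<omega>M by (intro measurable_const_on_atom[OF V]) auto
    with mem show ?thesis by (auto simp: V'_def)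
  qed
  \<comment> \<open>Independence factors the integral of \<open>V'\<close> over \<open>?A\<close>,
    where \<open>V'\<close> equals \<open>V\<close>; the nonzero factor \<open>prob ?A\<close> is
    then cancelled.\<close>
  have "prob ?A *\<^sub>R (\<integral>\<omega>. V' \<omega> \<partial>M) = (\<integral>\<omega>. indicator ?A \<omega> *\<^sub>R V' \<omega> \<partial>M)"
    by (rule integral_indicator_indep[OF G AM indep_F_G[OF t A] V'_G, symmetric])
  also have "\<dots> = (\<integral>\<omega>. indicator ?A \<omega> *\<^sub>R V \<omega> \<partial>M)"
    by (intro Bochner_Integration.integral_cong refl) (auto simp: indicator_def V'_eq)
  also have "\<dots> = 0" by (rule 0[OF A])
  finally have "(\<integral>\<omega>. V' \<omega> \<partial>M) = 0" using pos by simp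
  with V'_G integrable_finite_subalgebra[OF G finite_G[OF t] V'_G]
  have "V' \<in> centered_increments M (WW (Suc t)) (W (Suc t))"
    using t by (subst centered_increments_iff) auto
  with V'_eq show thesis using that by blast
qed

text \<open>A centered function may be chosen afresh on each atom of \<open>F t\<close>. With
  \<open>V\<close> written as the finite sum of \<open>indicator A\<close> times \<open>C A\<close>,
  independence makes every term integrate to zero over each set of \<open>F t\<close>.\<close>

lemma centered_glue:
  fixes C :: "'a set \<Rightarrow> 'a \<Rightarrow> real ^ 'm"
  assumes t: "t < T"
    and C: "\<And>A. A \<in> atoms (F t) \<Longrightarrow> C A \<in> centered_increments M (WW (Suc t)) (W (Suc t))"
  defines "V \<equiv> \<lambda>\<omega>. C (atom (F t) \<omega>) \<omega>"
  shows "V \<in> borel_measurable (F (Suc t))" "integrable M V"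
    "\<And>B. B \<in> sets (F t) \<Longrightarrow> (\<integral>\<omega>. indicator B \<omega> *\<^sub>R V \<omega> \<partial>M) = 0"
proof -
  have fin: "finite (sets (F t))" using t by (intro finite_F) auto
  have G: "subalgebra M (G (Suc t))" using t by (intro subalgebra_G) auto
  have FM: "A \<in> sets M" if "A \<in> sets (F t)" for A
    using that subalgebra_F[of t] t by (auto simp: subalgebra_def)
  have CG: "C A \<in> borel_measurable (G (Suc t))" and Ci: "integrable M (C A)"
    and C0: "(\<integral>\<omega>. C A \<omega> \<partial>M) = 0" if "A \<in> atoms (F t)" for A
    using C[OF that] t by (auto simp: centered_increments_iff)
  have V: "V \<omega> = (\<Sum>A\<in>atoms (F t). indicator A \<omega> *\<^sub>R C A \<omega>)" if "\<omega> \<in> space M" for \<omega>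
    using that by (subst sum_atoms_single[OF fin, of \<omega>]) (auto simp: V_def atom_self)
  have "(\<lambda>\<omega>. \<Sum>A\<in>atoms (F t). indicator A \<omega> *\<^sub>R C A \<omega>) \<in> borel_measurable (F (Suc t))"
  proof (intro borel_measurable_sum borel_measurable_scaleR borel_measurable_indicator)
    fix A assume A: "A \<in> atoms (F t)"
    show "A \<in> sets (F (Suc t))"
      using atoms_sets[OF fin A] subalgebra_F_Suc[of t] by (auto simp: subalgebra_def)
    show "C A \<in> borel_measurable (F (Suc t))"
      by (rule measurable_from_subalg[OF subalgebra_F_G CG[OF A]])
  qed
  then show "V \<in> borel_measurable (F (Suc t))"
    using V by (subst measurable_cong[of _ _ "\<lambda>\<omega>. \<Sum>A\<in>atoms (F t). indicator A \<omega> *\<^sub>R C A \<omega>"]) auto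
  have "integrable M (\<lambda>\<omega>. \<Sum>A\<in>atoms (F t). indicator A \<omega> *\<^sub>R C A \<omega>)"
    by (intro Bochner_Integration.integrable_sum integrable_mult_indicator Ci FM atoms_sets[OF fin])
  then show "integrable M V"
    using V by (subst Bochner_Integration.integrable_cong) auto
  fix B assume B: "B \<in> sets (F t)"
  have "(\<integral>\<omega>. indicator B \<omega> *\<^sub>R V \<omega> \<partial>M)
      = (\<integral>\<omega>. (\<Sum>A\<in>atoms (F t). indicator (B \<inter> A) \<omega> *\<^sub>R C A \<omega>) \<partial>M)"
    by (intro Bochner_Integration.integral_cong refl)
      (simp add: V scaleR_sum_right indicator_inter_arith)
  also have "\<dots> = (\<Sum>A\<in>atoms (F t). \<integral>\<omega>. indicator (B \<inter> A) \<omega> *\<^sub>R C A \<omega> \<partial>M)"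
    by (intro Bochner_Integration.integral_sum integrable_mult_indicator Ci sets.Int FM B
        atoms_sets[OF fin])
  also have "\<dots> = 0"
  proof (intro sum.neutral ballI)
    fix A assume A: "A \<in> atoms (F t)"
    have BA: "B \<inter> A \<in> sets (F t)" using B atoms_sets[OF fin A] by blast
    have "(\<integral>\<omega>. indicator (B \<inter> A) \<omega> *\<^sub>R C A \<omega> \<partial>M) = prob (B \<inter> A) *\<^sub>R (\<integral>\<omega>. C A \<omega> \<partial>M)"
      by (rule integral_indicator_indep[OF G FM[OF BA] indep_F_G[OF t BA] CG[OF A]])
    then show "(\<integral>\<omega>. indicator (B \<inter> A) \<omega> *\<^sub>R C A \<omega> \<partial>M) = 0" using C0[OF A] by simp
  qed
  finally show "(\<integral>\<omega>. indicator B \<omega> *\<^sub>R V \<omega> \<partial>M) = 0" .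
qed

end

section \<open>Dynamic programming\<close>

text \<open>Only the recursion and measurability are assumed of \<open>v\<close>; the terminal
  condition, with \<open>K\<close> and \<open>g\<close>, enters in
  \<open>optimal_value_eq_value\<close>. The one-step estimates thus concern any measurable solution
  of the recursion.\<close>

locale bellman = finite_noise M T WW W
  for M :: "'a measure" and T and WW :: "nat \<Rightarrow> 'w measure" and W +
  fixes XX :: "nat \<Rightarrow> 'x measure" and UU :: "nat \<Rightarrow> 'u measure"
    and f :: "nat \<Rightarrow> 'x \<times> 'u \<times> 'w \<Rightarrow> 'x" and L :: "nat \<Rightarrow> 'x \<times> 'u \<times> 'w \<Rightarrow> ennreal"
    and v :: "nat \<Rightarrow> 'x \<times> (real ^ 'm) \<Rightarrow> ennreal"
  assumes measurable_dynamics: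
      "\<And>t. t < T \<Longrightarrow> f t \<in> XX t \<Otimes>\<^sub>M UU t \<Otimes>\<^sub>M WW (Suc t) \<rightarrow>\<^sub>M XX (Suc t)"
    and measurable_cost:
      "\<And>t. t < T \<Longrightarrow> L t \<in> XX t \<Otimes>\<^sub>M UU t \<Otimes>\<^sub>M WW (Suc t) \<rightarrow>\<^sub>M borel"
    and measurable_value: "\<And>t. t \<le> T \<Longrightarrow> v t \<in> XX t \<Otimes>\<^sub>M borel \<rightarrow>\<^sub>M borel"
    and bellman_equation: "\<And>t x z. t < T \<Longrightarrow> x \<in> space (XX t) \<Longrightarrow>
      v t (x, z) =
        (INF u\<in>space (UU t). INF V\<in>centered_increments M (WW (Suc t)) (W (Suc t)).
           \<integral>\<^sup>+ \<omega>. L t (x, u, W (Suc t) \<omega>) + v (Suc t) (f t (x, u, W (Suc t) \<omega>), z + V \<omega>) \<partial>M)"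
begin

section \<open>The one-stage problem\<close>

abbreviation increments :: "nat \<Rightarrow> ('a \<Rightarrow> real ^ 'm) set" where
  "increments t \<equiv> centered_increments M (WW (Suc t)) (W (Suc t))"

text \<open>The last argument is the state after the increment, which is why
  \<open>stage_value\<close> passes \<open>z + V \<omega>\<close>.\<close>

definition cost_to_go :: "nat \<Rightarrow> 'x \<Rightarrow> 'u \<Rightarrow> 'w \<Rightarrow> real ^ 'm \<Rightarrow> ennreal" where
  "cost_to_go t x u w z = L t (x, u, w) + v (Suc t) (f t (x, u, w), z)"

definition stage_value :: "nat \<Rightarrow> 'x \<Rightarrow> real ^ 'm \<Rightarrow> 'u \<Rightarrow> ('a \<Rightarrow> real ^ 'm) \<Rightarrow> ennreal" where
  "stage_value t x z u V = (\<integral>\<^sup>+\<omega>. cost_to_go t x u (W (Suc t) \<omega>) (z + V \<omega>) \<partial>M)"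

lemma bellman_stage_value:
  "t < T \<Longrightarrow> x \<in> space (XX t) \<Longrightarrow>
    v t (x, z) = (INF u\<in>space (UU t). INF V\<in>increments t. stage_value t x z u V)"
  by (simp add: bellman_equation stage_value_def cost_to_go_def)

lemma value_le_stage_value:
  assumes "t < T" "x \<in> space (XX t)" "u \<in> space (UU t)" "V \<in> increments t"
  shows "v t (x, z) \<le> stage_value t x z u V"
  unfolding bellman_stage_value[OF assms(1,2)]
  by (rule INF_lower2[OF assms(3)], rule INF_lower[OF assms(4)])

text \<open>At infinite value any control with the zero increment will do; at finite value
  \<open>v t (x, z) + \<epsilon>\<close> strictly exceeds the infimum.\<close>

lemma almost_optimal:
  fixes \<epsilon> :: ennreal
  assumes "t < T" "x \<in> space (XX t)" "space (UU t) \<noteq> {}" "0 < \<epsilon>"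
  obtains u V where "u \<in> space (UU t)" "V \<in> increments t"
    "stage_value t x z u V \<le> v t (x, z) + \<epsilon>"
proof (cases "v t (x, z) = \<infinity>")
  case True
  with assms that[of _ "\<lambda>_. 0"] zero_centered[of "Suc t"] show ?thesis by fastforce
next
  case False
  then have "v t (x, z) < v t (x, z) + \<epsilon>"
    using assms(4) by (simp add: ennreal_add_left_cancel_less less_top)
  then have "(INF u\<in>space (UU t). INF V\<in>increments t. stage_value t x z u V) < v t (x, z) + \<epsilon>"
    using bellman_stage_value[OF assms(1,2)] by simp
  then show ?thesis using that by (auto simp: INF_less_iff intro: less_imp_le)
qed

text \<open>An infimum over an empty control set is infinite, and this propagates backwards: the
  dynamics stay inside the state spaces, so the earlier integrands are infinite everywhere. Read
  contrapositively, a finite initial value guarantees that controls can be chosen.\<close>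

lemma value_infinite_if_no_control:
  assumes "s \<le> t" "t < T" "space (UU t) = {}" "x \<in> space (XX s)"
  shows "v s (x, z) = \<infinity>"
  using assms
proof (induction s arbitrary: x z rule: inc_induct)
  case base
  then show ?case by (simp add: bellman_equation)
next
  case (step n)
  have "stage_value n x z u V = \<infinity>" if u: "u \<in> space (UU n)" for u V
  proof -
    have "f n (x, u, W (Suc n) \<omega>) \<in> space (XX (Suc n))" if "\<omega> \<in> space M" for \<omega>
      using that u step.prems step.hyps measurable_space[OF measurable_noise, of "Suc n"]
      by (intro measurable_space[OF measurable_dynamics]) (auto simp: space_pair_measure)
    then have "stage_value n x z u V = (\<integral>\<^sup>+\<omega>. \<infinity> \<partial>M)"
      unfolding stage_value_def cost_to_go_def
      using step.IH step.prems by (intro nn_integral_cong) auto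
    then show ?thesis by (simp add: emeasure_space_1)
  qed
  then show ?case
    using step.prems step.hyps by (simp add: bellman_stage_value)
qed

section \<open>One Bellman step along an adapted process\<close>

lemma measurable_cost_to_go:
  assumes t: "t < T" and "X \<in> N \<rightarrow>\<^sub>M XX t" "U \<in> N \<rightarrow>\<^sub>M UU t" "w \<in> N \<rightarrow>\<^sub>M WW (Suc t)"
    "Z \<in> borel_measurable N"
  shows "(\<lambda>\<omega>. cost_to_go t (X \<omega>) (U \<omega>) (w \<omega>) (Z \<omega>)) \<in> borel_measurable N"
proof -
  have p: "(\<lambda>\<omega>. (X \<omega>, U \<omega>, w \<omega>)) \<in> N \<rightarrow>\<^sub>M XX t \<Otimes>\<^sub>M UU t \<Otimes>\<^sub>M WW (Suc t)"
    using assms by measurable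
  have "(\<lambda>\<omega>. (f t (X \<omega>, U \<omega>, w \<omega>), Z \<omega>)) \<in> N \<rightarrow>\<^sub>M XX (Suc t) \<Otimes>\<^sub>M borel"
    using measurable_compose[OF p measurable_dynamics[OF t]] assms by measurable
  from measurable_compose[OF this measurable_value[of "Suc t"]]
    measurable_compose[OF p measurable_cost[OF t]] t
  show ?thesis unfolding cost_to_go_def by simp
qed

lemma measurable_value_process:
  assumes "t \<le> T" "X \<in> N \<rightarrow>\<^sub>M XX t" "Z \<in> borel_measurable N"
  shows "(\<lambda>\<omega>. v t (X \<omega>, Z \<omega>)) \<in> borel_measurable N"
  using assms by (intro measurable_compose[OF _ measurable_value[of t]] measurable_Pair) auto

text \<open>The control space may fail to separate points, so \<open>X\<close> and \<open>U\<close> need not be constant on an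
  atom; their composites with the measurable functions \<open>L\<close> and \<open>v\<close> are.\<close>

lemma nn_integral_atom_cost_to_go:
  assumes t: "t < T" and X: "X \<in> F t \<rightarrow>\<^sub>M XX t" and U: "U \<in> F t \<rightarrow>\<^sub>M UU t"
    and Z: "Z \<in> borel_measurable (F t)" and V': "V' \<in> increments t" and \<omega>0: "\<omega>0 \<in> space M"
    and eq: "\<And>\<omega>. \<omega> \<in> atom (F t) \<omega>0 \<Longrightarrow> V \<omega> = V' \<omega>"
  shows "(\<integral>\<^sup>+\<omega>. cost_to_go t (X \<omega>) (U \<omega>) (W (Suc t) \<omega>) (Z \<omega> + V \<omega>)
             * indicator (atom (F t) \<omega>0) \<omega> \<partial>M)
       = emeasure M (atom (F t) \<omega>0) * stage_value t (X \<omega>0) (Z \<omega>0) (U \<omega>0) V'"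
proof -
  let ?A = "atom (F t) \<omega>0"
  have A: "?A \<in> sets (F t)" using t \<omega>0 by (intro sets_atom finite_F) auto
  then have AM: "?A \<in> sets M"
    using subalgebra_F[of t] t by (auto simp: subalgebra_def)
  have G: "subalgebra M (G (Suc t))" using t by (intro subalgebra_G) auto
  have const: "cost_to_go t (X \<omega>) (U \<omega>) (W (Suc t) \<omega>) (Z \<omega> + V \<omega>)
      = cost_to_go t (X \<omega>0) (U \<omega>0) (W (Suc t) \<omega>) (Z \<omega>0 + V' \<omega>)" if \<omega>: "\<omega> \<in> ?A" for \<omega>
  proof -
    have "W (Suc t) \<omega> \<in> space (WW (Suc t))"
      using \<omega> \<omega>0 atom_subset_space[of \<omega>0 "F t"] t
      by (intro measurable_space[OF measurable_noise]) auto
    \<comment> \<open>The noise and the increment are frozen at \<open>\<omega>\<close> while the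
      other arguments vary; the resulting function is \<open>F t\<close>-measurable and so constant
      on the atom.\<close>
    then have "(\<lambda>\<omega>'. cost_to_go t (X \<omega>') (U \<omega>') (W (Suc t) \<omega>) (Z \<omega>' + V' \<omega>))
        \<in> borel_measurable (F t)"
      using X U Z by (intro measurable_cost_to_go[OF t]) auto
    from measurable_const_on_atom[OF this _ \<omega>] \<omega>0 eq[OF \<omega>] show ?thesis by simp
  qed
  have "(\<integral>\<^sup>+\<omega>. cost_to_go t (X \<omega>) (U \<omega>) (W (Suc t) \<omega>) (Z \<omega> + V \<omega>) * indicator ?A \<omega> \<partial>M)
      = (\<integral>\<^sup>+\<omega>. cost_to_go t (X \<omega>0) (U \<omega>0) (W (Suc t) \<omega>) (Z \<omega>0 + V' \<omega>) * indicator ?A \<omega> \<partial>M)"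
    by (intro nn_integral_cong) (auto simp: indicator_def const)
  also have "\<dots> = emeasure M ?A * stage_value t (X \<omega>0) (Z \<omega>0) (U \<omega>0) V'"
    unfolding stage_value_def
  proof (rule nn_integral_indicator_indep[OF G AM indep_F_G[OF t A]])
    have [measurable]: "V' \<in> borel_measurable (G (Suc t))"
      using V' t by (simp add: centered_increments_iff)
    show "(\<lambda>\<omega>. cost_to_go t (X \<omega>0) (U \<omega>0) (W (Suc t) \<omega>) (Z \<omega>0 + V' \<omega>))
        \<in> borel_measurable (G (Suc t))"
      using \<omega>0 t measurable_space[OF X] measurable_space[OF U]
      by (intro measurable_cost_to_go[OF t] measurable_noise_G) auto
  qed
  finally show ?thesis .
qed

text \<open>The constant \<open>c\<close> is 0 in the lower bound and the error
  \<open>\<epsilon>\<close> in the upper bound.\<close>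

lemma nn_integral_atom_value:
  assumes t: "t \<le> T" and X: "X \<in> F t \<rightarrow>\<^sub>M XX t" and Z: "Z \<in> borel_measurable (F t)"
    and \<omega>0: "\<omega>0 \<in> space M"
  shows "(\<integral>\<^sup>+\<omega>. (v t (X \<omega>, Z \<omega>) + c) * indicator (atom (F t) \<omega>0) \<omega> \<partial>M)
       = emeasure M (atom (F t) \<omega>0) * (v t (X \<omega>0, Z \<omega>0) + c)"
proof -
  let ?A = "atom (F t) \<omega>0"
  have "?A \<in> sets (F t)" using t \<omega>0 by (intro sets_atom finite_F) auto
  then have AM: "?A \<in> sets M"
    using subalgebra_F[of t] t by (auto simp: subalgebra_def)
  have "v t (X \<omega>, Z \<omega>) = v t (X \<omega>0, Z \<omega>0)" if "\<omega> \<in> ?A" for \<omega>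
    using measurable_const_on_atom[OF measurable_value_process[OF t X Z] _ that] \<omega>0 by simp
  then have "(\<integral>\<^sup>+\<omega>. (v t (X \<omega>, Z \<omega>) + c) * indicator ?A \<omega> \<partial>M)
      = (\<integral>\<^sup>+\<omega>. (v t (X \<omega>0, Z \<omega>0) + c) * indicator ?A \<omega> \<partial>M)"
    by (intro nn_integral_cong) (auto simp: indicator_def)
  also have "\<dots> = emeasure M ?A * (v t (X \<omega>0, Z \<omega>0) + c)"
    using AM by (simp add: nn_integral_cmult_indicator mult.commute)
  finally show ?thesis .
qed

lemma measurable_process_cost_to_go:
  assumes t: "t < T" and X: "X \<in> F t \<rightarrow>\<^sub>M XX t" and U: "U \<in> F t \<rightarrow>\<^sub>M UU t"
    and Z: "Z \<in> borel_measurable (F t)" and V: "V \<in> borel_measurable (F (Suc t))"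
  shows "(\<lambda>\<omega>. cost_to_go t (X \<omega>) (U \<omega>) (W (Suc t) \<omega>) (Z \<omega> + V \<omega>)) \<in> borel_measurable (F (Suc t))"
  using V by (intro measurable_cost_to_go[OF t] borel_measurable_add
      measurable_F_Suc[OF X] measurable_F_Suc[OF U] measurable_F_Suc[OF Z] measurable_noise_F[OF t])

text \<open>An integrated submartingale property: on each atom of positive probability, the current
  control and the extended increment compete in the Bellman infimum.\<close>

lemma value_le_step:
  assumes t: "t < T" and X: "X \<in> F t \<rightarrow>\<^sub>M XX t" and U: "U \<in> F t \<rightarrow>\<^sub>M UU t"
    and Z: "Z \<in> borel_measurable (F t)" and V: "V \<in> borel_measurable (F (Suc t))"
    and 0: "\<And>A. A \<in> sets (F t) \<Longrightarrow> (\<integral>\<omega>. indicator A \<omega> *\<^sub>R V \<omega> \<partial>M) = 0"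
  shows "(\<integral>\<^sup>+\<omega>. v t (X \<omega>, Z \<omega>) \<partial>M)
    \<le> (\<integral>\<^sup>+\<omega>. cost_to_go t (X \<omega>) (U \<omega>) (W (Suc t) \<omega>) (Z \<omega> + V \<omega>) \<partial>M)"
proof (rule nn_integral_mono_atoms)
  show "subalgebra M (F t)" "finite (sets (F t))"
    using t by (auto intro!: subalgebra_F finite_F)
  then show "(\<lambda>\<omega>. v t (X \<omega>, Z \<omega>)) \<in> borel_measurable M"
    using t by (intro measurable_from_subalg[OF _ measurable_value_process[OF _ X Z]]) auto
  show "(\<lambda>\<omega>. cost_to_go t (X \<omega>) (U \<omega>) (W (Suc t) \<omega>) (Z \<omega> + V \<omega>)) \<in> borel_measurable M"
    using t
    by (intro measurable_from_subalg[OF subalgebra_F measurable_process_cost_to_go[OF t X U Z V]]) auto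
  fix \<omega>0 assume \<omega>0: "\<omega>0 \<in> space M"
  let ?A = "atom (F t) \<omega>0"
  have vA: "(\<integral>\<^sup>+\<omega>. v t (X \<omega>, Z \<omega>) * indicator ?A \<omega> \<partial>M) = emeasure M ?A * v t (X \<omega>0, Z \<omega>0)"
    using nn_integral_atom_value[OF _ X Z \<omega>0, of 0] t by simp
  show "(\<integral>\<^sup>+\<omega>. v t (X \<omega>, Z \<omega>) * indicator ?A \<omega> \<partial>M)
    \<le> (\<integral>\<^sup>+\<omega>. cost_to_go t (X \<omega>) (U \<omega>) (W (Suc t) \<omega>) (Z \<omega> + V \<omega>) * indicator ?A \<omega> \<partial>M)"
  \<comment> \<open>On a null atom \<open>centered_extension\<close> does not apply, but
    \<open>vA\<close> makes the left side 0, even where \<open>v t\<close> is infinite.\<close>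
  proof (cases "prob ?A = 0")
    case True
    then show ?thesis unfolding vA by (simp add: emeasure_eq_measure)
  next
    case False
    from centered_extension[OF t V 0 \<omega>0 this] obtain V'
      where V': "V' \<in> increments t" "\<And>\<omega>. \<omega> \<in> ?A \<Longrightarrow> V' \<omega> = V \<omega>" by blast
    have "v t (X \<omega>0, Z \<omega>0) \<le> stage_value t (X \<omega>0) (Z \<omega>0) (U \<omega>0) V'"
      using \<omega>0 measurable_space[OF X] measurable_space[OF U] V'(1)
      by (intro value_le_stage_value[OF t]) auto
    then show ?thesis
      unfolding vA by (subst nn_integral_atom_cost_to_go[OF t X U Z V'(1) \<omega>0])
        (auto simp: V'(2) intro: mult_left_mono)
  qed
qed

text \<open>Near optimality at one point of each atom suffices, because both atomwise integrals can
  be evaluated at any point of the atom.\<close>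

lemma step_le_value:
  assumes t: "t < T" and X: "X \<in> F t \<rightarrow>\<^sub>M XX t" and U: "U \<in> F t \<rightarrow>\<^sub>M UU t"
    and Z: "Z \<in> borel_measurable (F t)" and V: "V \<in> borel_measurable (F (Suc t))"
    and opt: "\<And>A. A \<in> atoms (F t) \<Longrightarrow> \<exists>\<omega>\<in>A. \<exists>V'\<in>increments t. (\<forall>\<omega>'\<in>A. V \<omega>' = V' \<omega>') \<and>
      stage_value t (X \<omega>) (Z \<omega>) (U \<omega>) V' \<le> v t (X \<omega>, Z \<omega>) + \<epsilon>"
  shows "(\<integral>\<^sup>+\<omega>. cost_to_go t (X \<omega>) (U \<omega>) (W (Suc t) \<omega>) (Z \<omega> + V \<omega>) \<partial>M)
    \<le> (\<integral>\<^sup>+\<omega>. v t (X \<omega>, Z \<omega>) \<partial>M) + \<epsilon>"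
proof -
  have vM: "(\<lambda>\<omega>. v t (X \<omega>, Z \<omega>)) \<in> borel_measurable M"
    using t by (intro measurable_from_subalg[OF subalgebra_F measurable_value_process[OF _ X Z]]) auto
  have "(\<integral>\<^sup>+\<omega>. cost_to_go t (X \<omega>) (U \<omega>) (W (Suc t) \<omega>) (Z \<omega> + V \<omega>) \<partial>M)
    \<le> (\<integral>\<^sup>+\<omega>. v t (X \<omega>, Z \<omega>) + \<epsilon> \<partial>M)"
  proof (rule nn_integral_mono_atoms)
    show "subalgebra M (F t)" "finite (sets (F t))"
      using t by (auto intro!: subalgebra_F finite_F)
    show "(\<lambda>\<omega>. v t (X \<omega>, Z \<omega>) + \<epsilon>) \<in> borel_measurable M"
      using vM by simp
    show "(\<lambda>\<omega>. cost_to_go t (X \<omega>) (U \<omega>) (W (Suc t) \<omega>) (Z \<omega> + V \<omega>)) \<in> borel_measurable M"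
      using t by (intro measurable_from_subalg[OF subalgebra_F
            measurable_process_cost_to_go[OF t X U Z V]]) auto
    fix \<omega>0 assume \<omega>0: "\<omega>0 \<in> space M"
    then have "atom (F t) \<omega>0 \<in> atoms (F t)" by (simp add: atoms_def)
    from opt[OF this] obtain \<omega> V' where \<omega>: "\<omega> \<in> atom (F t) \<omega>0" and V': "V' \<in> increments t"
      and eq: "\<And>\<omega>'. \<omega>' \<in> atom (F t) \<omega>0 \<Longrightarrow> V \<omega>' = V' \<omega>'"
      and le: "stage_value t (X \<omega>) (Z \<omega>) (U \<omega>) V' \<le> v t (X \<omega>, Z \<omega>) + \<epsilon>" by blast
    have at: "atom (F t) \<omega>0 = atom (F t) \<omega>" and \<omega>M: "\<omega> \<in> space M"
      using atom_eq[of \<omega>0 "F t" \<omega>] \<omega>0 \<omega> atom_subset_space[of \<omega>0 "F t"] by auto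
    show "(\<integral>\<^sup>+\<omega>. cost_to_go t (X \<omega>) (U \<omega>) (W (Suc t) \<omega>) (Z \<omega> + V \<omega>) * indicator (atom (F t) \<omega>0) \<omega> \<partial>M)
      \<le> (\<integral>\<^sup>+\<omega>. (v t (X \<omega>, Z \<omega>) + \<epsilon>) * indicator (atom (F t) \<omega>0) \<omega> \<partial>M)"
      unfolding at nn_integral_atom_value[OF less_imp_le[OF t] X Z \<omega>M]
      by (subst nn_integral_atom_cost_to_go[OF t X U Z V' \<omega>M])
        (use eq at in \<open>auto intro: mult_left_mono[OF le]\<close>)
  qed
  also have "\<dots> = (\<integral>\<^sup>+\<omega>. v t (X \<omega>, Z \<omega>) \<partial>M) + \<epsilon>"
    using vM by (simp add: nn_integral_add emeasure_space_1)
  finally show ?thesis .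
qed

section \<open>Trajectories and their truncated costs\<close>

definition adapted_trajectory ::
  "'x \<Rightarrow> real ^ 'm \<Rightarrow> (nat \<Rightarrow> 'a \<Rightarrow> 'u) \<Rightarrow> (nat \<Rightarrow> 'a \<Rightarrow> real ^ 'm) \<Rightarrow>
    (nat \<Rightarrow> 'a \<Rightarrow> 'x) \<Rightarrow> (nat \<Rightarrow> 'a \<Rightarrow> real ^ 'm) \<Rightarrow> bool" where
  "adapted_trajectory x0 z0 U V X Z \<longleftrightarrow>
    x0 \<in> space (XX 0) \<and>
    (\<forall>\<omega>\<in>space M. X 0 \<omega> = x0 \<and> Z 0 \<omega> = z0) \<and>
    (\<forall>t<T. U t \<in> F t \<rightarrow>\<^sub>M UU t \<and> V t \<in> borel_measurable (F (Suc t)) \<and>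
      (\<forall>\<omega>\<in>space M. X (Suc t) \<omega> = f t (X t \<omega>, U t \<omega>, W (Suc t) \<omega>) \<and>
        Z (Suc t) \<omega> = Z t \<omega> + V t \<omega>))"

text \<open>Adaptedness of the states is inherited through the dynamics: the decision known at
  \<open>t\<close> and the noise \<open>W (Suc t)\<close> are all measurable for
  \<open>F (Suc t)\<close>.\<close>

lemma adapted_trajectory_measurable:
  assumes tr: "adapted_trajectory x0 z0 U V X Z" and "t \<le> T"
  shows "X t \<in> F t \<rightarrow>\<^sub>M XX t \<and> Z t \<in> borel_measurable (F t)"
  using assms(2)
proof (induction t)
  case 0
  have "(\<lambda>_. x0) \<in> F 0 \<rightarrow>\<^sub>M XX 0" "(\<lambda>_. z0) \<in> borel_measurable (F 0)"
    using tr by (auto simp: adapted_trajectory_def)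
  then show ?case
    using tr measurable_cong[of "F 0" "X 0" "\<lambda>_. x0"] measurable_cong[of "F 0" "Z 0" "\<lambda>_. z0"]
    by (auto simp: adapted_trajectory_def)
next
  case (Suc t)
  then have t: "t < T" and X: "X t \<in> F t \<rightarrow>\<^sub>M XX t" and Z: "Z t \<in> borel_measurable (F t)" by auto
  have U: "U t \<in> F t \<rightarrow>\<^sub>M UU t" and [measurable]: "V t \<in> borel_measurable (F (Suc t))"
    and eq: "\<And>\<omega>. \<omega> \<in> space M \<Longrightarrow> X (Suc t) \<omega> = f t (X t \<omega>, U t \<omega>, W (Suc t) \<omega>)"
      "\<And>\<omega>. \<omega> \<in> space M \<Longrightarrow> Z (Suc t) \<omega> = Z t \<omega> + V t \<omega>"
    using tr t by (auto simp: adapted_trajectory_def)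
  note [measurable] = measurable_F_Suc[OF X] measurable_F_Suc[OF U] measurable_F_Suc[OF Z]
    measurable_noise_F[OF t]
  have "(\<lambda>\<omega>. (X t \<omega>, U t \<omega>, W (Suc t) \<omega>)) \<in> F (Suc t) \<rightarrow>\<^sub>M XX t \<Otimes>\<^sub>M UU t \<Otimes>\<^sub>M WW (Suc t)"
    by measurable
  from measurable_compose[OF this measurable_dynamics[OF t]]
  have "X (Suc t) \<in> F (Suc t) \<rightarrow>\<^sub>M XX (Suc t)"
    by (subst measurable_cong) (auto simp: eq)
  moreover have "(\<lambda>\<omega>. Z t \<omega> + V t \<omega>) \<in> borel_measurable (F (Suc t))" by measurable
  then have "Z (Suc t) \<in> borel_measurable (F (Suc t))"
    by (subst measurable_cong) (auto simp: eq)
  ultimately show ?case ..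
qed

text \<open>Interpolates between \<open>v 0 (x0, z0)\<close> at \<open>n = 0\<close> and, under the
  final constraint, the expected cost at \<open>n = T\<close>: the first \<open>n\<close> stages are
  paid as incurred and the rest is priced by \<open>v n\<close>.\<close>

definition truncated_cost ::
  "(nat \<Rightarrow> 'a \<Rightarrow> 'u) \<Rightarrow> (nat \<Rightarrow> 'a \<Rightarrow> 'x) \<Rightarrow> (nat \<Rightarrow> 'a \<Rightarrow> real ^ 'm) \<Rightarrow> nat \<Rightarrow> ennreal" where
  "truncated_cost U X Z n =
    (\<integral>\<^sup>+\<omega>. (\<Sum>s<n. L s (X s \<omega>, U s \<omega>, W (Suc s) \<omega>)) + v n (X n \<omega>, Z n \<omega>) \<partial>M)"

lemma truncated_cost_0:
  assumes "adapted_trajectory x0 z0 U V X Z"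
  shows "truncated_cost U X Z 0 = v 0 (x0, z0)"
proof -
  have "truncated_cost U X Z 0 = (\<integral>\<^sup>+\<omega>. v 0 (x0, z0) \<partial>M)"
    unfolding truncated_cost_def
    using assms by (intro nn_integral_cong) (auto simp: adapted_trajectory_def)
  then show ?thesis by (simp add: emeasure_space_1)
qed

text \<open>Both quantities share the cost \<open>R\<close> of the first \<open>n\<close> stages, so
  comparing them is a single Bellman step. They are written as sums rather than a difference because
  \<open>R\<close> may be infinite.\<close>

lemma truncated_cost_split:
  assumes tr: "adapted_trajectory x0 z0 U V X Z" and n: "n < T"
  defines "R \<equiv> (\<integral>\<^sup>+\<omega>. (\<Sum>s<n. L s (X s \<omega>, U s \<omega>, W (Suc s) \<omega>)) \<partial>M)"
  shows "truncated_cost U X Z n = R + (\<integral>\<^sup>+\<omega>. v n (X n \<omega>, Z n \<omega>) \<partial>M)"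
    "truncated_cost U X Z (Suc n)
      = R + (\<integral>\<^sup>+\<omega>. cost_to_go n (X n \<omega>) (U n \<omega>) (W (Suc n) \<omega>) (Z n \<omega> + V n \<omega>) \<partial>M)"
proof -
  note meas = adapted_trajectory_measurable[OF tr]
  have U: "U t \<in> F t \<rightarrow>\<^sub>M UU t" and V: "V t \<in> borel_measurable (F (Suc t))" if "t < T" for t
    using tr that by (auto simp: adapted_trajectory_def)
  have Lm: "(\<lambda>\<omega>. L s (X s \<omega>, U s \<omega>, W (Suc s) \<omega>)) \<in> borel_measurable M" if s: "s < T" for s
  proof (rule measurable_compose[OF _ measurable_cost[OF s]])
    show "(\<lambda>\<omega>. (X s \<omega>, U s \<omega>, W (Suc s) \<omega>)) \<in> M \<rightarrow>\<^sub>M XX s \<Otimes>\<^sub>M UU s \<Otimes>\<^sub>M WW (Suc s)"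
      using meas[of s] U[OF s] measurable_noise[of "Suc s"] s
      by (intro measurable_Pair) (auto intro: measurable_F_M)
  qed
  have Rm: "(\<lambda>\<omega>. \<Sum>s<n. L s (X s \<omega>, U s \<omega>, W (Suc s) \<omega>)) \<in> borel_measurable M"
    using n by (intro borel_measurable_sum Lm) auto
  have "(\<lambda>\<omega>. v n (X n \<omega>, Z n \<omega>)) \<in> borel_measurable M"
    using meas[of n] n by (intro measurable_F_M[OF measurable_value_process]) auto
  with Rm show "truncated_cost U X Z n = R + (\<integral>\<^sup>+\<omega>. v n (X n \<omega>, Z n \<omega>) \<partial>M)"
    unfolding truncated_cost_def R_def by (rule nn_integral_add)
  have "truncated_cost U X Z (Suc n) = (\<integral>\<^sup>+\<omega>. (\<Sum>s<n. L s (X s \<omega>, U s \<omega>, W (Suc s) \<omega>))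
      + cost_to_go n (X n \<omega>) (U n \<omega>) (W (Suc n) \<omega>) (Z n \<omega> + V n \<omega>) \<partial>M)"
    unfolding truncated_cost_def cost_to_go_def
    using tr n by (intro nn_integral_cong) (auto simp: adapted_trajectory_def add.assoc)
  also have "\<dots> = R + (\<integral>\<^sup>+\<omega>. cost_to_go n (X n \<omega>) (U n \<omega>) (W (Suc n) \<omega>) (Z n \<omega> + V n \<omega>) \<partial>M)"
    unfolding R_def using meas[of n] n U[OF n] V[OF n]
    by (intro nn_integral_add Rm measurable_F_M[OF measurable_process_cost_to_go]) auto
  finally show "truncated_cost U X Z (Suc n)
      = R + (\<integral>\<^sup>+\<omega>. cost_to_go n (X n \<omega>) (U n \<omega>) (W (Suc n) \<omega>) (Z n \<omega> + V n \<omega>) \<partial>M)" .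
qed

text \<open>By \<open>value_le_step\<close> the truncated cost is nondecreasing in
  \<open>n\<close>.\<close>

lemma value_le_truncated_cost:
  assumes tr: "adapted_trajectory x0 z0 U V X Z" and "n \<le> T"
    and 0: "\<And>t A. t < T \<Longrightarrow> A \<in> sets (F t) \<Longrightarrow> (\<integral>\<omega>. indicator A \<omega> *\<^sub>R V t \<omega> \<partial>M) = 0"
  shows "v 0 (x0, z0) \<le> truncated_cost U X Z n"
  using assms(2)
proof (induction n)
  case 0
  show ?case by (simp add: truncated_cost_0[OF tr])
next
  case (Suc n)
  then have n: "n < T" by simp
  have "truncated_cost U X Z n \<le> truncated_cost U X Z (Suc n)"
    unfolding truncated_cost_split[OF tr n]
    using adapted_trajectory_measurable[OF tr, of n] tr n 0[OF n]
    by (intro add_left_mono value_le_step) (auto simp: adapted_trajectory_def)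
  with Suc n show ?case by simp
qed

text \<open>By \<open>step_le_value\<close> each stage adds at most \<open>\<epsilon>\<close>, and
  the errors accumulate linearly.\<close>

lemma truncated_cost_le_value:
  assumes tr: "adapted_trajectory x0 z0 U V X Z" and "n \<le> T"
    and opt: "\<And>t A. t < T \<Longrightarrow> A \<in> atoms (F t) \<Longrightarrow>
      \<exists>\<omega>\<in>A. \<exists>V'\<in>increments t. (\<forall>\<omega>'\<in>A. V t \<omega>' = V' \<omega>') \<and>
        stage_value t (X t \<omega>) (Z t \<omega>) (U t \<omega>) V' \<le> v t (X t \<omega>, Z t \<omega>) + \<epsilon>"
  shows "truncated_cost U X Z n \<le> v 0 (x0, z0) + of_nat n * \<epsilon>"
  using assms(2)
proof (induction n)
  case 0
  show ?case by (simp add: truncated_cost_0[OF tr])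
next
  case (Suc n)
  then have n: "n < T" by simp
  have "truncated_cost U X Z (Suc n) \<le> truncated_cost U X Z n + \<epsilon>"
    unfolding truncated_cost_split[OF tr n] add.assoc
    using adapted_trajectory_measurable[OF tr, of n] tr n opt[OF n]
    by (intro add_left_mono step_le_value) (auto simp: adapted_trajectory_def)
  also have "\<dots> \<le> v 0 (x0, z0) + of_nat n * \<epsilon> + \<epsilon>"
    using Suc n by (intro add_right_mono) auto
  finally show ?case by (simp add: algebra_simps)
qed

text \<open>The almost optimal decisions are evaluated at a representative of the current atom: the state
  itself may vary within the atom, in which case a decision depending on it pointwise would not be
  adapted.\<close>

lemma almost_optimal_trajectory:
  fixes \<epsilon> :: ennreal
  assumes x0: "x0 \<in> space (XX 0)" and controls: "\<And>t. t < T \<Longrightarrow> space (UU t) \<noteq> {}" and "0 < \<epsilon>"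
  obtains U V X Z where "adapted_trajectory x0 z0 U V X Z"
    "\<And>t. t < T \<Longrightarrow> integrable M (V t)"
    "\<And>t A. t < T \<Longrightarrow> A \<in> sets (F t) \<Longrightarrow> (\<integral>\<omega>. indicator A \<omega> *\<^sub>R V t \<omega> \<partial>M) = 0"
    "truncated_cost U X Z T \<le> v 0 (x0, z0) + of_nat T * \<epsilon>"
proof -
  \<comment> \<open>The guards stay under the existential quantifier, so that choice yields total
    functions of \<open>t\<close> and \<open>p\<close>.\<close>
  have "\<exists>u V. t < T \<longrightarrow> fst p \<in> space (XX t) \<longrightarrow> u \<in> space (UU t) \<and> V \<in> increments t \<and>
      stage_value t (fst p) (snd p) u V \<le> v t p + \<epsilon>" for t p
    using almost_optimal[of t "fst p" \<epsilon> "snd p"] controls \<open>0 < \<epsilon>\<close> by (metis prod.collapse)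
  then obtain u c where uc: "t < T \<Longrightarrow> fst p \<in> space (XX t) \<Longrightarrow> u t p \<in> space (UU t) \<and>
      c t p \<in> increments t \<and> stage_value t (fst p) (snd p) (u t p) (c t p) \<le> v t p + \<epsilon>" for t p
    by metis
  define r where "r t \<omega> = representative (atom (F t) \<omega>)" for t \<omega>
  \<comment> \<open>The recursion runs over whole functions on the sample space: the state at
    \<open>\<omega>\<close> is updated by a decision read off from the state at another point,
    \<open>r t \<omega>\<close>.\<close>
  define S where "S = rec_nat (\<lambda>_. (x0, z0)) (\<lambda>t s \<omega>.
    (f t (fst (s \<omega>), u t (s (r t \<omega>)), W (Suc t) \<omega>), snd (s \<omega>) + c t (s (r t \<omega>)) \<omega>))"
  have S_0: "S 0 \<omega> = (x0, z0)" for \<omega> by (simp add: S_def)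
  have S_Suc: "S (Suc t) \<omega> = (f t (fst (S t \<omega>), u t (S t (r t \<omega>)), W (Suc t) \<omega>),
      snd (S t \<omega>) + c t (S t (r t \<omega>)) \<omega>)" for t \<omega>
    by (simp add: S_def)
  have r_space: "r t \<omega> \<in> space M" if "\<omega> \<in> space M" for t \<omega>
    using representative_atom[of "F t" \<omega>] atom_subset_space[of \<omega> "F t"] that by (auto simp: r_def)
  have S_space: "fst (S t \<omega>) \<in> space (XX t)" if "t \<le> T" "\<omega> \<in> space M" for t \<omega>
    using that
  proof (induction t arbitrary: \<omega>)
    case 0
    then show ?case by (simp add: S_0 x0)
  next
    case (Suc t)
    then have "(fst (S t \<omega>), u t (S t (r t \<omega>)), W (Suc t) \<omega>)
        \<in> space (XX t \<Otimes>\<^sub>M UU t \<Otimes>\<^sub>M WW (Suc t))"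
      using uc[of t "S t (r t \<omega>)"] r_space[of \<omega> t] measurable_space[OF measurable_noise, of "Suc t" \<omega>]
      by (auto simp: space_pair_measure)
    from measurable_space[OF measurable_dynamics this] Suc.prems show ?case by (simp add: S_Suc)
  qed
  define U where "U t \<omega> = u t (S t (r t \<omega>))" for t \<omega>
  define V where "V t \<omega> = c t (S t (r t \<omega>)) \<omega>" for t \<omega>
  define X where "X t \<omega> = fst (S t \<omega>)" for t \<omega>
  define Z where "Z t \<omega> = snd (S t \<omega>)" for t \<omega>
  have r_const: "r t \<omega>' = r t \<omega>" if "\<omega> \<in> space M" "\<omega>' \<in> atom (F t) \<omega>" for t \<omega> \<omega>'
    using atom_eq[of \<omega> "F t" \<omega>'] that by (simp add: r_def)
  have U_meas: "U t \<in> F t \<rightarrow>\<^sub>M UU t" if "t < T" for t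
    using that uc r_space S_space r_const
    by (intro measurable_if_const_on_atoms finite_F) (auto simp: U_def)
  \<comment> \<open>Exhibits the increment as one centered function per atom, the form that
    \<open>centered_glue\<close> expects.\<close>
  have V_eq: "V t = (\<lambda>\<omega>. (\<lambda>A. c t (S t (representative A))) (atom (F t) \<omega>) \<omega>)" for t
    by (simp add: V_def r_def fun_eq_iff)
  have C: "c t (S t (representative A)) \<in> increments t" if "t < T" "A \<in> atoms (F t)" for t A
    using that uc[of t "S t (representative A)"] S_space[of t] r_space by (auto simp: atoms_def r_def)
  have V: "V t \<in> borel_measurable (F (Suc t))" "integrable M (V t)"
    "\<And>A. A \<in> sets (F t) \<Longrightarrow> (\<integral>\<omega>. indicator A \<omega> *\<^sub>R V t \<omega> \<partial>M) = 0" if "t < T" for t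
    unfolding V_eq by (rule centered_glue[OF that C[OF that]]; assumption?)+
  have tr: "adapted_trajectory x0 z0 U V X Z"
    using x0 U_meas V(1)
    by (auto simp: adapted_trajectory_def X_def Z_def S_0 S_Suc U_def V_def)
  show thesis
  proof (rule that[OF tr V(2,3)])
    show "truncated_cost U X Z T \<le> v 0 (x0, z0) + of_nat T * \<epsilon>"
    proof (rule truncated_cost_le_value[OF tr order_refl], intro bexI conjI ballI)
      fix t A assume t: "t < T" and A: "A \<in> atoms (F t)"
      then obtain \<omega> where \<omega>: "\<omega> \<in> space M" "A = atom (F t) \<omega>" by (auto simp: atoms_def)
      \<comment> \<open>The representative is the witness, since there the state used for the
        decision is the actual state.\<close>
      let ?\<omega> = "representative A"
      show rA: "?\<omega> \<in> A" using \<omega> representative_atom by simp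
      have r: "r t \<omega>' = ?\<omega>" if "\<omega>' \<in> A" for \<omega>'
        using r_const[of \<omega> \<omega>' t] that \<omega> by (simp add: r_def)
      show "c t (S t ?\<omega>) \<in> increments t" by (rule C[OF t A])
      show "V t \<omega>' = c t (S t ?\<omega>) \<omega>'" if "\<omega>' \<in> A" for \<omega>'
        by (simp add: V_def r[OF that])
      have "?\<omega> \<in> space M" using r_space[OF \<omega>(1), of t] \<omega> by (simp add: r_def)
      then show "stage_value t (X t ?\<omega>) (Z t ?\<omega>) (U t ?\<omega>) (c t (S t ?\<omega>))
          \<le> v t (X t ?\<omega>, Z t ?\<omega>) + \<epsilon>"
        using uc[OF t, of "S t ?\<omega>"] S_space[of t ?\<omega>] t
        by (simp add: X_def Z_def U_def r[OF rA])
    qed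
  qed auto
qed

text \<open>Inclusions of generated sigma-fields become measurability, vanishing conditional
  expectations become vanishing integrals, and measurability of \<open>X\<close> and
  \<open>Z\<close> is recovered from the dynamics.\<close>

lemma admissible_iff_adapted:
  assumes "x0 \<in> space (XX 0)"
  shows "admissible M T XX UU WW W f g x0 z0 U V X Z \<longleftrightarrow>
    adapted_trajectory x0 z0 U V X Z \<and>
    (\<forall>t<T. integrable M (V t)) \<and>
    (\<forall>t<T. \<forall>A\<in>sets (F t). (\<integral>\<omega>. indicator A \<omega> *\<^sub>R V t \<omega> \<partial>M) = 0) \<and>
    (AE \<omega> in M. g (X T \<omega>) - Z T \<omega> \<le> 0)"
proof (intro iffI conjI)
  assume a: "admissible M T XX UU WW W f g x0 z0 U V X Z"
  have "U t \<in> F t \<rightarrow>\<^sub>M UU t" "V t \<in> borel_measurable (F (Suc t))" if "t < T" for t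
    using a that measurable_iff_vimage_algebra_subset[of "U t" "F t" "UU t"]
      measurable_iff_vimage_algebra_subset[of "V t" "F (Suc t)" borel]
    by (auto simp: admissible_def dest: measurable_space)
  with a assms show "adapted_trajectory x0 z0 U V X Z"
    by (auto simp: admissible_def adapted_trajectory_def)
  show "\<forall>t<T. \<forall>A\<in>sets (F t). (\<integral>\<omega>. indicator A \<omega> *\<^sub>R V t \<omega> \<partial>M) = 0"
  proof (intro allI impI)
    fix t assume t: "t < T"
    with a have "integrable M (V t)"
      "\<forall>i. AE \<omega> in M. real_cond_exp M (F t) (\<lambda>\<omega>. V t \<omega> $ i) \<omega> = 0"
      by (auto simp: admissible_def)
    with cond_exp_zero_iff[of t "V t"] t
    show "\<forall>A\<in>sets (F t). (\<integral>\<omega>. indicator A \<omega> *\<^sub>R V t \<omega> \<partial>M) = 0" by simp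
  qed
next
  assume a: "adapted_trajectory x0 z0 U V X Z \<and> (\<forall>t<T. integrable M (V t)) \<and>
    (\<forall>t<T. \<forall>A\<in>sets (F t). (\<integral>\<omega>. indicator A \<omega> *\<^sub>R V t \<omega> \<partial>M) = 0) \<and>
    (AE \<omega> in M. g (X T \<omega>) - Z T \<omega> \<le> 0)"
  then have tr: "adapted_trajectory x0 z0 U V X Z" by blast
  have U: "U t \<in> F t \<rightarrow>\<^sub>M UU t" and V: "V t \<in> borel_measurable (F (Suc t))" if "t < T" for t
    using tr that by (auto simp: adapted_trajectory_def)
  have "U t \<in> M \<rightarrow>\<^sub>M UU t \<and> V t \<in> borel_measurable M \<and>
      sets (vimage_algebra (space M) (U t) (UU t)) \<subseteq> sets (F t) \<and>
      sets (vimage_algebra (space M) (V t) borel) \<subseteq> sets (F (Suc t)) \<and>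
      (\<forall>i. AE \<omega> in M. real_cond_exp M (F t) (\<lambda>\<omega>. V t \<omega> $ i) \<omega> = 0)" if t: "t < T" for t
  proof (intro conjI)
    show "U t \<in> M \<rightarrow>\<^sub>M UU t" "V t \<in> borel_measurable M"
      using measurable_F_M[OF U[OF t]] measurable_F_M[OF V[OF t]] t by auto
    show "sets (vimage_algebra (space M) (U t) (UU t)) \<subseteq> sets (F t)"
      using measurable_iff_vimage_algebra_subset[of "U t" "F t" "UU t"] U[OF t]
        measurable_space[OF U[OF t]] by (simp add: Pi_iff)
    show "sets (vimage_algebra (space M) (V t) borel) \<subseteq> sets (F (Suc t))"
      using measurable_iff_vimage_algebra_subset[of "V t" "F (Suc t)" borel] V[OF t] by auto
    show "\<forall>i. AE \<omega> in M. real_cond_exp M (F t) (\<lambda>\<omega>. V t \<omega> $ i) \<omega> = 0"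
      using cond_exp_zero_iff[of t "V t"] a t by simp
  qed
  moreover have "X t \<in> M \<rightarrow>\<^sub>M XX t \<and> Z t \<in> borel_measurable M" if "t \<le> T" for t
    using adapted_trajectory_measurable[OF tr that] measurable_F_M[OF _ that, of "X t" "XX t"]
      measurable_F_M[OF _ that, of "Z t" borel] by blast
  moreover have "\<forall>\<omega>\<in>space M. X 0 \<omega> = x0" "\<forall>\<omega>\<in>space M. Z 0 \<omega> = z0"
    "\<forall>t<T. \<forall>\<omega>\<in>space M. X (Suc t) \<omega> = f t (X t \<omega>, U t \<omega>, W (Suc t) \<omega>)"
    "\<forall>t<T. \<forall>\<omega>\<in>space M. Z (Suc t) \<omega> = Z t \<omega> + V t \<omega>"
    using tr by (simp_all add: adapted_trajectory_def)
  moreover have "\<forall>t<T. integrable M (V t)" "AE \<omega> in M. g (X T \<omega>) - Z T \<omega> \<le> 0"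
    using a by blast+
  ultimately show "admissible M T XX UU WW W f g x0 z0 U V X Z"
    unfolding admissible_def by (intro conjI allI impI) simp_all
qed (auto simp: admissible_def)

section \<open>Equality of the optimal value and the value function\<close>

lemma optimal_value_eq_value:
  fixes K :: "'x \<Rightarrow> ennreal" and g :: "'x \<Rightarrow> real ^ 'm"
  assumes x0: "x0 \<in> space (XX 0)"
    and terminal: "\<And>x z. x \<in> space (XX T) \<Longrightarrow> v T (x, z) = K x + (if g x - z \<le> 0 then 0 else \<infinity>)"
  shows "optimal_value M T XX UU WW W f L K g x0 z0 = v 0 (x0, z0)"
proof (rule antisym)
  have X_space: "X T \<omega> \<in> space (XX T)"
    if "adapted_trajectory x0 z0 U V X Z" "\<omega> \<in> space M" for U V X Z \<omega>
    using adapted_trajectory_measurable[OF that(1), of T] that(2) by (auto dest: measurable_space)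
  show "optimal_value M T XX UU WW W f L K g x0 z0 \<le> v 0 (x0, z0)"
  proof (rule ennreal_le_epsilon)
    fix e :: real assume fin: "v 0 (x0, z0) < top" and e: "0 < e"
    \<comment> \<open>The \<open>T\<close> stages lose \<open>\<epsilon>\<close> each, at most
      \<open>e\<close> in total; \<open>Suc T\<close> keeps the denominator positive.\<close>
    define \<epsilon> where "\<epsilon> = ennreal (e / real (Suc T))"
    have "0 < \<epsilon>" using e by (simp add: \<epsilon>_def)
    have "of_nat T * \<epsilon> = ennreal (real T * (e / real (Suc T)))"
      unfolding \<epsilon>_def using e by (subst ennreal_mult) (simp_all add: ennreal_of_nat_eq_real_of_nat)
    also have "\<dots> \<le> ennreal e"
      using e by (intro ennreal_leI) (simp add: field_simps)
    finally have \<epsilon>: "v 0 (x0, z0) + of_nat T * \<epsilon> \<le> v 0 (x0, z0) + ennreal e"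
      by (rule add_left_mono)
    have "space (UU t) \<noteq> {}" if "t < T" for t
      using value_infinite_if_no_control[of 0 t x0 z0] that fin x0 by auto
    from almost_optimal_trajectory[OF x0 this \<open>0 < \<epsilon>\<close>, of z0] obtain U V X Z
      where tr: "adapted_trajectory x0 z0 U V X Z"
        and V: "\<And>t. t < T \<Longrightarrow> integrable M (V t)"
          "\<And>t A. t < T \<Longrightarrow> A \<in> sets (F t) \<Longrightarrow> (\<integral>\<omega>. indicator A \<omega> *\<^sub>R V t \<omega> \<partial>M) = 0"
        and le: "truncated_cost U X Z T \<le> v 0 (x0, z0) + of_nat T * \<epsilon>"
      by blast
    \<comment> \<open>Where the final constraint fails, \<open>v T\<close> is infinite; finiteness
      of its integral confines this failure to a null set.\<close>
    have "(\<integral>\<^sup>+\<omega>. v T (X T \<omega>, Z T \<omega>) \<partial>M) \<le> truncated_cost U X Z T"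
      unfolding truncated_cost_def by (intro nn_integral_mono) simp
    also have "\<dots> < \<infinity>"
      using le \<epsilon> fin by (auto simp: less_top[symmetric] top_unique)
    finally have "(\<integral>\<^sup>+\<omega>. v T (X T \<omega>, Z T \<omega>) \<partial>M) \<noteq> \<infinity>" by simp
    moreover have "(\<lambda>\<omega>. v T (X T \<omega>, Z T \<omega>)) \<in> borel_measurable M"
      using adapted_trajectory_measurable[OF tr, of T]
      by (intro measurable_F_M[OF measurable_value_process]) auto
    ultimately have "AE \<omega> in M. v T (X T \<omega>, Z T \<omega>) \<noteq> \<infinity>"
      by (intro nn_integral_PInf_AE) auto
    then have "AE \<omega> in M. g (X T \<omega>) - Z T \<omega> \<le> 0"
      using AE_space by eventually_elim (auto simp: terminal X_space[OF tr] split: if_splits)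
    then have "admissible M T XX UU WW W f g x0 z0 U V X Z"
      using tr V by (simp add: admissible_iff_adapted[OF x0])
    then have "optimal_value M T XX UU WW W f L K g x0 z0 \<le> expected_cost M T W L K U X"
      unfolding optimal_value_def by (intro Inf_lower) blast
    also have "\<dots> \<le> truncated_cost U X Z T"
      unfolding expected_cost_def truncated_cost_def
      by (intro nn_integral_mono add_left_mono) (simp add: terminal X_space[OF tr])
    also note le
    also note \<epsilon>
    finally show "optimal_value M T XX UU WW W f L K g x0 z0 \<le> v 0 (x0, z0) + ennreal e" .
  qed
  show "v 0 (x0, z0) \<le> optimal_value M T XX UU WW W f L K g x0 z0"
    unfolding optimal_value_def
  proof (rule Inf_greatest, safe)
    fix U V X Z assume "admissible M T XX UU WW W f g x0 z0 U V X Z"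
    then have tr: "adapted_trajectory x0 z0 U V X Z"
      and V: "\<And>t A. t < T \<Longrightarrow> A \<in> sets (F t) \<Longrightarrow> (\<integral>\<omega>. indicator A \<omega> *\<^sub>R V t \<omega> \<partial>M) = 0"
      and g: "AE \<omega> in M. g (X T \<omega>) - Z T \<omega> \<le> 0"
      by (auto simp: admissible_iff_adapted[OF x0])
    have "v 0 (x0, z0) \<le> truncated_cost U X Z T"
      by (rule value_le_truncated_cost[OF tr order_refl V])
    \<comment> \<open>The almost sure constraint removes the penalty from \<open>v T\<close> outside
      a null set.\<close>
    also have "\<dots> = expected_cost M T W L K U X"
      unfolding expected_cost_def truncated_cost_def
    proof (rule nn_integral_cong_AE)
      show "AE \<omega> in M. (\<Sum>s<T. L s (X s \<omega>, U s \<omega>, W (Suc s) \<omega>)) + v T (X T \<omega>, Z T \<omega>)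
          = (\<Sum>s<T. L s (X s \<omega>, U s \<omega>, W (Suc s) \<omega>)) + K (X T \<omega>)"
        using g AE_space by eventually_elim (simp add: terminal X_space[OF tr])
    qed
    finally show "v 0 (x0, z0) \<le> expected_cost M T W L K U X" .
  qed
qed

end

theorem mainTheorem2:
  fixes M :: "'a measure" and T :: nat
    and XX :: "nat \<Rightarrow> 'x measure" and UU :: "nat \<Rightarrow> 'u measure" and WW :: "nat \<Rightarrow> 'w measure"
    and W :: "nat \<Rightarrow> 'a \<Rightarrow> 'w"
    and f :: "nat \<Rightarrow> 'x \<times> 'u \<times> 'w \<Rightarrow> 'x" and L :: "nat \<Rightarrow> 'x \<times> 'u \<times> 'w \<Rightarrow> ennreal"
    and K :: "'x \<Rightarrow> ennreal" and g :: "'x \<Rightarrow> real ^ 'm"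
    and \<V> :: "nat \<Rightarrow> 'x \<times> (real ^ 'm) \<Rightarrow> ennreal"
    and x0 :: 'x and z0 :: "real ^ 'm"
  assumes "prob_space M" and "T > 0"
    and "\<And>t. t \<in> {1..T} \<Longrightarrow> W t \<in> M \<rightarrow>\<^sub>M WW t"
    and "\<And>t. t < T \<Longrightarrow> f t \<in> XX t \<Otimes>\<^sub>M UU t \<Otimes>\<^sub>M WW (Suc t) \<rightarrow>\<^sub>M XX (Suc t)"
    and "\<And>t. t < T \<Longrightarrow> L t \<in> XX t \<Otimes>\<^sub>M UU t \<Otimes>\<^sub>M WW (Suc t) \<rightarrow>\<^sub>M borel"
    and "K \<in> XX T \<rightarrow>\<^sub>M borel"
    and "g \<in> XX T \<rightarrow>\<^sub>M borel" and "\<And>x. x \<in> space (XX T) \<Longrightarrow> 0 \<le> g x"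
    and "prob_space.indep_vars M WW W {1..T}"
    and "finite ((\<lambda>\<omega>. \<lambda>t\<in>{1..T}. W t \<omega>) ` space M)"
    and "\<And>x z. x \<in> space (XX T) \<Longrightarrow> \<V> T (x, z) = K x + (if g x - z \<le> 0 then 0 else \<infinity>)"
    and "\<And>t x z. t < T \<Longrightarrow> x \<in> space (XX t) \<Longrightarrow>
      \<V> t (x, z) =
        (INF u\<in>space (UU t). INF V\<in>centered_increments M (WW (Suc t)) (W (Suc t)).
           \<integral>\<^sup>+ \<omega>. L t (x, u, W (Suc t) \<omega>) + \<V> (Suc t) (f t (x, u, W (Suc t) \<omega>), z + V \<omega>) \<partial>M)"
    and "\<And>t. t \<le> T \<Longrightarrow> \<V> t \<in> XX t \<Otimes>\<^sub>M borel \<rightarrow>\<^sub>M borel"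
    and "x0 \<in> space (XX 0)"
  shows "optimal_value M T XX UU WW W f L K g x0 z0 = \<V> 0 (x0, z0)"
proof -
  interpret prob_space M by fact
  interpret bellman M T WW W XX UU f L \<V>
    by unfold_locales (fact assms)+
  show ?thesis by (rule optimal_value_eq_value) (fact assms)+
qed

end
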